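(* Let $X$ be a locally path-connected metrizable space with $X\in AP(n,0)$. Then every point $x\in X$ is a homological $Z_{n-1}$-point in $X$, i.e., $H_k(U,U\setminus\{x\})=0$ for every open set $U\subset X$ and every $k<n$.
   Context: $H_*$ denotes relative singular homology with integer coefficients. A map is $0$-dimensional if all fibers have covering dimension $\le0$. For a compatible metric on $X$ and $\varepsilon>0$, maps $g,g'\colon\mathbb I^n\to X$ are $\varepsilon$-homotopic if there is a homotopy $h\colon\mathbb I^n\times[0,1]\to X$ from $g$ to $g'$ with $\mathrm{diam}\,h(\{z\}\times[0,1])<\varepsilon$ for all $z$. $X\in AP(n,0)$ means: for every $\varepsilon>0$ and map $g\colon\mathbb I^n\to X$ there is a $0$-dimensional map $g'\colon\mathbb I^n\to X$ $\varepsilon$-homotopic to $g$. *)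

theory Defs
  imports "HOL-Analysis.Analysis" "HOL-Homology.Homology"
begin

text \<open>The n-cube I^n, as the product topology of n copies of [0,1]
  (points are extensional functions nat \<Rightarrow> real supported on {..<n}).\<close>
definition cube :: "nat \<Rightarrow> (nat \<Rightarrow> real) topology" where
  "cube n = product_topology (\<lambda>i. top_of_set {0..1::real}) {..<n}"

definition covdim_le_0 :: "'a topology \<Rightarrow> bool" where
  "covdim_le_0 T \<longleftrightarrow>
    (\<forall>\<U>. finite \<U> \<and> (\<forall>U\<in>\<U>. openin T U) \<and> \<Union>\<U> = topspace T \<longrightarrow>
      (\<exists>\<V>. finite \<V> \<and> (\<forall>V\<in>\<V>. openin T V) \<and> \<Union>\<V> = topspace T \<and>
           pairwise disjnt \<V> \<and> (\<forall>V\<in>\<V>. \<exists>U\<in>\<U>. V \<subseteq> U)))"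

definition zero_dim_map :: "'a topology \<Rightarrow> 'b topology \<Rightarrow> ('a \<Rightarrow> 'b) \<Rightarrow> bool" where
  "zero_dim_map S X g \<longleftrightarrow>
    (\<forall>y \<in> topspace X. covdim_le_0 (subtopology S {z \<in> topspace S. g z = y}))"

definition mdiam :: "('a \<Rightarrow> 'a \<Rightarrow> real) \<Rightarrow> 'a set \<Rightarrow> real" where
  "mdiam d A = Sup {d x y | x y. x \<in> A \<and> y \<in> A}"

definition eps_homotopic ::
  "nat \<Rightarrow> 'a topology \<Rightarrow> ('a \<Rightarrow> 'a \<Rightarrow> real) \<Rightarrow> real \<Rightarrow>
   ((nat \<Rightarrow> real) \<Rightarrow> 'a) \<Rightarrow> ((nat \<Rightarrow> real) \<Rightarrow> 'a) \<Rightarrow> bool" where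
  "eps_homotopic n X d \<epsilon> g g' \<longleftrightarrow>
    (\<exists>h. continuous_map (prod_topology (cube n) (top_of_set {0..1::real})) X h \<and>
         (\<forall>z \<in> topspace (cube n). h (z, 0) = g z \<and> h (z, 1) = g' z) \<and>
         (\<forall>z \<in> topspace (cube n). mdiam d ((\<lambda>t. h (z, t)) ` {0..1}) < \<epsilon>))"

definition AP_n0 :: "nat \<Rightarrow> 'a topology \<Rightarrow> ('a \<Rightarrow> 'a \<Rightarrow> real) \<Rightarrow> bool" where
  "AP_n0 n X d \<longleftrightarrow>
    (\<forall>\<epsilon>>0. \<forall>g. continuous_map (cube n) X g \<longrightarrow>
       (\<exists>g'. continuous_map (cube n) X g' \<and> zero_dim_map (cube n) X g' \<and>
             eps_homotopic n X d \<epsilon> g g'))"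

end

theory Submission
  imports Defs
begin

text \<open>
  Let \<open>W\<close> be an open neighbourhood of \<open>x\<close>. For \<open>q < n\<close> every singular \<open>q\<close>-simplex \<open>\<sigma>\<close> of \<open>W\<close> is
  extended, naturally with respect to faces, to a map \<open>(h, u)\<close> from \<open>\<Delta>\<^sup>q \<times> [0,1]\<close> to
  \<open>W \<times> \<real>\<close> minus the point \<open>(x, 0)\<close>, with \<open>h = \<sigma>\<close>, \<open>u = -1\<close> on the bottom and \<open>u = 1\<close> on the top.
  The extension from the boundary is possible because \<open>\<Delta>\<^sup>q \<times> [0,1]\<close> is a retract of the \<open>n\<close>-cube:
  by \<open>AP(n,0)\<close> the map \<open>h\<close> may be perturbed so that \<open>h\<^sup>-\<^sup>1(x)\<close> is zero-dimensional, hence is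
  divided into two clopen parts by any prescription on the boundary, and \<open>u\<close> can be chosen negative
  on one part and positive on the other. The perturbation moves the boundary values slightly; this
  is absorbed in a collar, where \<open>h\<close> stays away from \<open>x\<close> whenever \<open>u = 0\<close>.

  So in \<open>W \<times> \<real>\<close> minus \<open>(x, 0)\<close> a cycle of \<open>W\<close> relative to \<open>W - {x}\<close>, placed at height \<open>-1\<close>, is
  homologous to one at positive height. Modulo \<open>(W - {x}) \<times> \<real>\<close> and everything above height 0 it
  therefore bounds, and excising \<open>W \<times> [0,\<infinity>)\<close> shows that it already bounds in \<open>(W, W - {x})\<close>.
\<close>

section \<open>Prisms and natural homotopies\<close>

abbreviation simplex_space :: "nat \<Rightarrow> (nat \<Rightarrow> real) topology" where
  "simplex_space q \<equiv> subtopology (powertop_real UNIV) (standard_simplex q)"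

abbreviation unit_interval :: "real topology" where
  "unit_interval \<equiv> top_of_set {0..1}"

definition cyl :: "nat \<Rightarrow> ((nat \<Rightarrow> real) \<times> real) topology" where
  "cyl q = prod_topology (simplex_space q) unit_interval"

lemma topspace_cyl [simp]: "topspace (cyl q) = standard_simplex q \<times> {0..1}"
  by (simp add: cyl_def)

lemma continuous_map_cyl_iff:
  "continuous_map Z (cyl q) f \<longleftrightarrow>
     (\<forall>i. continuous_map Z euclideanreal (\<lambda>x. fst (f x) i)) \<and>
     continuous_map Z euclideanreal (\<lambda>x. snd (f x)) \<and>
     (\<forall>x \<in> topspace Z. fst (f x) \<in> standard_simplex q \<and> snd (f x) \<in> {0..1})"
  unfolding cyl_def continuous_map_pairwise continuous_map_in_subtopology
    continuous_map_componentwise_UNIV o_def image_subset_iff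
  by (auto simp: Pi_iff)

text \<open>Singular simplices are extensional functions, hence \<open>restrict\<close>. Every
  singular \<open>q\<close>-simplex is the image of this one.\<close>

definition fundamental_chain :: "nat \<Rightarrow> (nat \<Rightarrow> real) chain" where
  "fundamental_chain q = frag_of (restrict id (standard_simplex q))"

lemma singular_simplex_restrict_id:
  "singular_simplex q (simplex_space q) (restrict id (standard_simplex q))"
  by (simp add: simplicial_imp_singular_simplex)

lemma singular_chain_fundamental: "singular_chain q (simplex_space q) (fundamental_chain q)"
  by (simp add: fundamental_chain_def singular_chain_of singular_simplex_restrict_id)

definition cyl_map :: "((nat \<Rightarrow> real) \<Rightarrow> 'a) \<Rightarrow> (nat \<Rightarrow> real) \<times> real \<Rightarrow> 'a \<times> real" where
  "cyl_map \<sigma> = (\<lambda>(p, t). (\<sigma> p, t))"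

text \<open>The chain \<open>d\<close> is a prism over the \<open>q\<close>-simplex, with copies of \<open>b\<close> as its side faces.\<close>
definition is_prism ::
  "nat \<Rightarrow> ((nat \<Rightarrow> real) \<times> real) chain \<Rightarrow> ((nat \<Rightarrow> real) \<times> real) chain \<Rightarrow> bool" where
  "is_prism q b d \<longleftrightarrow> singular_chain (Suc q) (cyl q) d \<and>
     chain_boundary (Suc q) d =
       chain_map q (\<lambda>p. (p, 1)) (fundamental_chain q) - chain_map q (\<lambda>p. (p, 0)) (fundamental_chain q)
       - frag_extend (\<lambda>\<sigma>. chain_map q (cyl_map \<sigma>) b) (chain_boundary q (fundamental_chain q))"

text \<open>The boundary formula of the universal prism \<open>d\<close> is pushed forward along
  \<open>H q \<sigma>\<close>. Naturality \<open>nat\<close> identifies the image of the side over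
  the \<open>k\<close>-th face with the prism over \<open>singular_face q k \<sigma>\<close>, and
  additivity passes from simplices to chains.\<close>

lemma prism_boundary:
  fixes H :: "nat \<Rightarrow> ((nat \<Rightarrow> real) \<Rightarrow> 'a) \<Rightarrow> (nat \<Rightarrow> real) \<times> real \<Rightarrow> 'b"
  assumes prism: "is_prism q b d"
    and b: "0 < q \<Longrightarrow> singular_chain q (cyl (q - 1)) b"
    and nat: "\<And>\<sigma> k p t. \<lbrakk>0 < q; singular_simplex q W \<sigma>; k \<le> q; p \<in> standard_simplex (q - 1);
               t \<in> {0..1}\<rbrakk> \<Longrightarrow> H (q - 1) (singular_face q k \<sigma>) (p, t) = H q \<sigma> (simplical_face k p, t)"
    and c: "singular_chain q W c"
  shows "chain_boundary (Suc q) (frag_extend (\<lambda>\<sigma>. chain_map (Suc q) (H q \<sigma>) d) c) =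
           frag_extend (\<lambda>\<sigma>. frag_of (restrict (\<lambda>p. H q \<sigma> (p, 1)) (standard_simplex q))) c
         - frag_extend (\<lambda>\<sigma>. frag_of (restrict (\<lambda>p. H q \<sigma> (p, 0)) (standard_simplex q))) c
         - frag_extend (\<lambda>\<sigma>. chain_map q (H (q - 1) \<sigma>) b) (chain_boundary q c)"
proof -
  have d: "singular_chain (Suc q) (cyl q) d"
    and bd: "chain_boundary (Suc q) d =
       chain_map q (\<lambda>p. (p, 1)) (fundamental_chain q) - chain_map q (\<lambda>p. (p, 0)) (fundamental_chain q)
       - frag_extend (\<lambda>\<sigma>. chain_map q (cyl_map \<sigma>) b) (chain_boundary q (fundamental_chain q))"
    using prism by (auto simp: is_prism_def)
  show ?thesis
    using c unfolding singular_chain_def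
  proof (induction c rule: frag_induction)
    case (one \<sigma>)
    then have \<sigma>: "singular_simplex q W \<sigma>" by simp
    have end_eq: "chain_map q (H q \<sigma>) (chain_map q (\<lambda>p. (p, s)) (fundamental_chain q)) =
        frag_of (restrict (\<lambda>p. H q \<sigma> (p, s)) (standard_simplex q))" for s
      by (auto simp: fundamental_chain_def simplex_map_def restrict_def fun_eq_iff intro!: arg_cong [where f = frag_of])
    \<comment> \<open>In degree 0 the boundary is 0 and there are no sides; this is why
      \<open>b\<close> and \<open>nat\<close> are only assumed for \<open>0 < q\<close>.\<close>
    have side_eq: "chain_map q (H q \<sigma>)
          (frag_extend (\<lambda>\<sigma>. chain_map q (cyl_map \<sigma>) b) (chain_boundary q (fundamental_chain q)))
        = frag_extend (\<lambda>\<sigma>. chain_map q (H (q - 1) \<sigma>) b) (chain_boundary q (frag_of \<sigma>))"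
    proof (cases "q = 0")
      case False
      have "chain_map q (H q \<sigma>) (chain_map q (cyl_map (singular_face q k (restrict id (standard_simplex q)))) b)
          = chain_map q (H (q - 1) (singular_face q k \<sigma>)) b" if "k \<le> q" for k
      proof -
        have "chain_map q (H q \<sigma> \<circ> cyl_map (singular_face q k (restrict id (standard_simplex q)))) b
          = chain_map q (H (q - 1) (singular_face q k \<sigma>)) b"
        proof (rule chain_map_eq [OF b])
          fix z assume "z \<in> topspace (cyl (q - 1))"
          then show "(H q \<sigma> \<circ> cyl_map (singular_face q k (restrict id (standard_simplex q)))) z
              = H (q - 1) (singular_face q k \<sigma>) z"
            using nat [OF _ \<sigma> that] False that
            by (auto simp: cyl_map_def singular_face_def simplical_face_in_standard_simplex)
        qed (use False in auto)
        then show ?thesis by (simp add: chain_map_compose)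
      qed
      then show ?thesis
        using False
        by (simp add: fundamental_chain_def chain_boundary_of frag_extend_sum frag_extend_cmul
            chain_map_sum o_def)
    qed (simp add: fundamental_chain_def chain_boundary_def)
    show ?case
      using chain_boundary_chain_map [OF d, of "H q \<sigma>"]
      by (simp add: bd chain_map_diff end_eq side_eq restrict_def)
  next
    case (diff a b)
    then show ?case
      by (simp add: chain_boundary_diff frag_extend_diff)
  qed auto
qed

lemma continuous_map_cyl_top: "s \<in> {0..1} \<Longrightarrow> continuous_map (simplex_space q) (cyl q) (\<lambda>p. (p, s))"
  by (simp add: cyl_def continuous_map_pairwise o_def)

section \<open>Acyclicity of the cylinder and existence of prisms\<close>

text \<open>The simplex is convex, so the cylinder contracts along straight lines to
  \<open>(a, 0)\<close>.\<close>

lemma contractible_cyl: "contractible_space (cyl q)"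
proof -
  obtain a where a: "a \<in> standard_simplex q" using nonempty_standard_simplex by blast
  have "continuous_map (prod_topology unit_interval (cyl q)) (cyl q)
          (\<lambda>(s, z). (\<lambda>i. (1 - s) * fst z i + s * a i, (1 - s) * snd z))"
  proof -
    let ?P = "prod_topology unit_interval (cyl q)"
    have c1: "continuous_map ?P euclideanreal fst"
      by (rule continuous_map_into_fulltopology [OF continuous_map_fst])
    have "continuous_map ?P (cyl q) snd"
      by (rule continuous_map_snd)
    then have c2: "continuous_map ?P euclideanreal (\<lambda>x. snd (snd x))"
      and c3: "\<And>i. continuous_map ?P euclideanreal (\<lambda>x. fst (snd x) i)"
      unfolding continuous_map_cyl_iff by blast+
    have "(1 - s) * t \<le> 1" if "0 \<le> s" "s \<le> 1" "0 \<le> t" "t \<le> 1" for s t :: real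
      using that by (simp add: mult_le_one)
    then show ?thesis
      by (auto simp: continuous_map_cyl_iff case_prod_unfold convex_standard_simplex a
          intro!: continuous_intros c1 c2 c3)
  qed
  then have "homotopic_with (\<lambda>x. True) (cyl q) (cyl q) id (\<lambda>x. (a, 0))"
    unfolding homotopic_with_def
    by (rule_tac x="(\<lambda>(s, z). (\<lambda>i. (1 - s) * fst z i + s * a i, (1 - s) * snd z))" in exI) auto
  then show ?thesis
    unfolding contractible_space_def by blast
qed

text \<open>Homotopy invariance makes \<open>c\<close> homologous to its image under a constant map.
  That image is a cycle of a one-point space, where all cycles of positive degree bound.\<close>

lemma contractible_cycle_bounds:
  assumes "contractible_space Y" "0 < q" "singular_chain q Y c" "chain_boundary q c = 0"
  shows "\<exists>d. singular_chain (Suc q) Y d \<and> chain_boundary (Suc q) d = c"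
proof -
  obtain a where a: "homotopic_with (\<lambda>x. True) Y Y id (\<lambda>x. a)"
    using assms(1) by (auto simp: contractible_space_def)
  have c: "singular_relcycle q Y {} c"
    using assms by (simp add: singular_cycle)
  have "homologous_rel q Y {} (chain_map q id c) (chain_map q (\<lambda>x. a) c)"
    using homotopic_imp_homologous_rel_chain_maps [of "{}" "{}" Y Y id "\<lambda>x. a" q c] a c by simp
  then have hom: "homologous_rel q Y {} c (chain_map q (\<lambda>x. a) c)"
    using assms(3) by (simp add: chain_map_ident)
  have cont: "continuous_map Y Y (\<lambda>x. a)"
    using a homotopic_with_imp_continuous_maps by blast
  have "singular_relboundary q Y {} (chain_map q (\<lambda>x. a) c)"
  proof (cases "topspace Y = {}")
    case True
    then have "c = 0" using assms(3) singular_chain_empty by blast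
    then show ?thesis by simp
  next
    case False
    then have aY: "a \<in> topspace Y" using cont by (auto simp: continuous_map_def)
    have cont': "continuous_map Y (subtopology Y {a}) (\<lambda>x. a)"
      using cont by (simp add: continuous_map_in_subtopology)
    have "singular_relcycle q (subtopology Y {a}) {} (chain_map q (\<lambda>x. a) c)"
      by (rule singular_relcycle_chain_map [OF c cont']) auto
    then have "singular_relboundary q (subtopology Y {a}) {} (chain_map q (\<lambda>x. a) c)"
      using singular_boundary_eq_cycle_singleton [of "subtopology Y {a}" a q] aY \<open>0 < q\<close> by auto
    then show ?thesis
      by (auto simp: singular_boundary dest: singular_chain_subtopology [THEN iffD1])
  qed
  with hom have "singular_relboundary q Y {} c"
    by (metis diff_add_cancel homologous_rel_def singular_relboundary_add)
  then show ?thesis by (auto simp: singular_boundary)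
qed

text \<open>Acyclic models: the ends and sides prescribed for the next prism form a cycle, and this
  cycle bounds because the cylinder is contractible.\<close>

lemma prism_chains_exist:
  obtains pr where "\<And>q. is_prism q (pr (q - 1)) (pr q)"
proof -
  \<comment> \<open>The recursion remembers that \<open>f q\<close> is a prism over some
    \<open>b\<close>: the boundary of its copies, needed at the next stage, involves
    \<open>b\<close>.\<close>
  have "\<exists>f. \<forall>q. (\<exists>b. is_prism q b (f q) \<and> (0 < q \<longrightarrow> singular_chain q (cyl (q - 1)) b)) \<and>
                is_prism (Suc q) (f q) (f (Suc q))"
  proof (rule dependent_nat_choice)
    \<comment> \<open>Over a single vertex a prism is just a homology from the bottom point to the
      top point.\<close>
    have hom: "homotopic_with (\<lambda>h. h \<in> {} \<rightarrow> {}) (simplex_space 0) (cyl 0) (\<lambda>p. (p, 0)) (\<lambda>p. (p, 1))"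
      unfolding homotopic_with_def
    proof (intro exI conjI)
      show "continuous_map (prod_topology unit_interval (simplex_space 0)) (cyl 0) (\<lambda>(t, p). (p, t))"
        using homeomorphic_imp_continuous_map [OF homeomorphic_map_swap] by (auto simp: cyl_def case_prod_unfold)
    qed auto
    have "singular_relcycle 0 (simplex_space 0) {} (fundamental_chain 0)"
      by (simp add: singular_cycle singular_chain_fundamental chain_boundary_def)
    then have "singular_relboundary 0 (cyl 0) {}
        (chain_map 0 (\<lambda>p. (p, 1)) (fundamental_chain 0) - chain_map 0 (\<lambda>p. (p, 0)) (fundamental_chain 0))"
      using homotopic_imp_homologous_rel_chain_maps [OF hom] homologous_rel_sym
      unfolding homologous_rel_def by metis
    then show "\<exists>x. \<exists>b. is_prism 0 b x \<and> (0 < (0::nat) \<longrightarrow> singular_chain 0 (cyl (0 - 1)) b)"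
      by (simp add: is_prism_def singular_boundary chain_boundary_def)
  next
    fix x :: "((nat \<Rightarrow> real) \<times> real) chain" and q
    assume "\<exists>b. is_prism q b x \<and> (0 < q \<longrightarrow> singular_chain q (cyl (q - 1)) b)"
    then obtain b where b: "is_prism q b x" "0 < q \<Longrightarrow> singular_chain q (cyl (q - 1)) b" by auto
    have x: "singular_chain (Suc q) (cyl q) x"
      using b by (simp add: is_prism_def)
    let ?\<iota> = "fundamental_chain (Suc q)"
    let ?side = "frag_extend (\<lambda>\<sigma>. chain_map (Suc q) (cyl_map \<sigma>) x) (chain_boundary (Suc q) ?\<iota>)"
    let ?z = "chain_map (Suc q) (\<lambda>p. (p, 1)) ?\<iota> - chain_map (Suc q) (\<lambda>p. (p, 0)) ?\<iota> - ?side"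
    have \<iota>: "singular_chain (Suc q) (simplex_space (Suc q)) ?\<iota>"
      by (rule singular_chain_fundamental)
    have d\<iota>: "singular_chain q (simplex_space (Suc q)) (chain_boundary (Suc q) ?\<iota>)"
      by (rule singular_chain_boundary_alt [OF \<iota>])
    have cyl_cont: "continuous_map (cyl q) (cyl (Suc q)) (cyl_map \<sigma>)"
      if "singular_simplex q (simplex_space (Suc q)) \<sigma>" for \<sigma>
      using that unfolding cyl_def cyl_map_def singular_simplex_def
      by (simp add: continuous_map_prod_top)
    have side: "singular_chain (Suc q) (cyl (Suc q)) ?side"
      by (intro singular_chain_extend singular_chain_chain_map [OF x] cyl_cont)
         (use d\<iota> in \<open>auto simp: singular_chain_def\<close>)
    have z: "singular_chain (Suc q) (cyl (Suc q)) ?z"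
      by (intro singular_chain_diff side singular_chain_chain_map [OF \<iota>] continuous_map_cyl_top) auto
    have bside: "chain_boundary (Suc q) ?side =
           frag_extend (\<lambda>\<sigma>. frag_of (restrict (\<lambda>p. cyl_map \<sigma> (p, 1)) (standard_simplex q))) (chain_boundary (Suc q) ?\<iota>)
         - frag_extend (\<lambda>\<sigma>. frag_of (restrict (\<lambda>p. cyl_map \<sigma> (p, 0)) (standard_simplex q))) (chain_boundary (Suc q) ?\<iota>)
         - frag_extend (\<lambda>\<sigma>. chain_map q (cyl_map \<sigma>) b) (chain_boundary q (chain_boundary (Suc q) ?\<iota>))"
      by (rule prism_boundary [OF b(1) b(2) _ d\<iota>, where H = "\<lambda>_. cyl_map"])
         (auto simp: cyl_map_def singular_face_def)
    have slice: "frag_extend (\<lambda>\<sigma>. frag_of (restrict (\<lambda>p. cyl_map \<sigma> (p, s)) (standard_simplex q))) c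
        = chain_map q (\<lambda>p. (p, s)) c" for s and c :: "(nat \<Rightarrow> real) chain"
      unfolding chain_map_def
      by (rule frag_extend_eq) (simp add: cyl_map_def simplex_map_def o_def)
    \<comment> \<open>The ends of \<open>?side\<close> cancel the boundaries of top and bottom, and
      its own sides are indexed by the boundary of a boundary.\<close>
    have "chain_boundary (Suc q) ?z = 0"
      by (simp add: chain_boundary_diff bside slice chain_boundary_chain_map [OF \<iota>]
          chain_boundary_boundary_alt [OF \<iota>])
    then obtain y where "singular_chain (Suc (Suc q)) (cyl (Suc q)) y" "chain_boundary (Suc (Suc q)) y = ?z"
      using contractible_cycle_bounds [OF contractible_cyl _ z] by auto
    then have "is_prism (Suc q) x y"
      by (simp add: is_prism_def)
    with x show "\<exists>y. (\<exists>b. is_prism (Suc q) b y \<and> (0 < Suc q \<longrightarrow> singular_chain (Suc q) (cyl (Suc q - 1)) b))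
        \<and> is_prism (Suc q) x y"
      by auto
  qed
  then obtain f where f: "\<And>q. \<exists>b. is_prism q b (f q)" "\<And>q. is_prism (Suc q) (f q) (f (Suc q))"
    by blast
  \<comment> \<open>For \<open>q = 0\<close> the index \<open>q - 1\<close> is again 0; the side
    term is then empty, so any chain may stand in for \<open>b\<close>.\<close>
  have "is_prism q (f (q - 1)) (f q)" for q
  proof (cases q)
    case 0
    then show ?thesis using f(1) [of 0] by (auto simp: is_prism_def chain_boundary_def)
  next
    case (Suc m)
    then show ?thesis using f(2) [of m] by simp
  qed
  then show ?thesis using that by blast
qed

lemma singular_relcycle_imp_chain: "singular_relcycle p X S c \<Longrightarrow> singular_chain p X c"
  by (simp add: singular_relcycle)

section \<open>Excision of the upper half and vanishing of relative homology\<close>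

text \<open>Excision of the closed upper half \<open>Z\<close> from \<open>(Y, T)\<close> leaves the
  pair \<open>(A, T - Z)\<close> of points below height 0. The copy of \<open>c\<close> at height -1
  bounds there as well, by injectivity of the excision map, and \<open>fst\<close> carries it back
  to \<open>c\<close> in \<open>W\<close> relative to \<open>W - {x}\<close>.\<close>

lemma relboundary_if_bottom_relboundary:
  fixes W :: "'a topology" and x :: 'a
  defines "Y \<equiv> subtopology (prod_topology W euclideanreal) (- {(x, 0)})"
  assumes c: "singular_relcycle q W (topspace W - {x}) c"
    and bot: "singular_relboundary q Y {z. fst z \<noteq> x \<or> snd z > 0} (chain_map q (\<lambda>p. (p, -1)) c)"
    and clo: "closedin W {x}"
  shows "singular_relboundary q W (topspace W - {x}) c"
proof -
  define T where "T = topspace Y \<inter> {z. fst z \<noteq> x \<or> snd z > (0::real)}"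
  define Z where "Z = topspace Y \<inter> {z. snd z \<ge> (0::real)}"
  define A where "A = subtopology Y (topspace Y - Z)"
  have topY: "topspace Y = topspace W \<times> UNIV - {(x, 0)}"
    by (auto simp: Y_def)
  have cf: "continuous_map Y W fst"
    unfolding Y_def by (simp add: continuous_map_from_subtopology continuous_map_fst)
  have cs: "continuous_map Y euclideanreal snd"
    unfolding Y_def by (simp add: continuous_map_from_subtopology continuous_map_snd)
  have T_eq: "T = {z \<in> topspace Y. fst z \<in> topspace W - {x}} \<union> {z \<in> topspace Y. snd z \<in> {0<..}}"
    by (auto simp: T_def topY)
  have opT: "openin Y T"
    unfolding T_eq using clo
    by (intro openin_Un openin_continuous_map_preimage [OF cf] openin_continuous_map_preimage [OF cs]) auto
  have Z_eq: "Z = {z \<in> topspace Y. snd z \<in> {0..}}"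
    by (auto simp: Z_def)
  have clZ: "closedin Y Z"
    unfolding Z_eq by (intro closedin_continuous_map_preimage [OF cs]) auto
  \<comment> \<open>Over \<open>x\<close> the height 0 is missing from \<open>Y\<close>, so
    \<open>Z\<close> meets that fibre only at positive heights.\<close>
  have "Z \<subseteq> T" by (auto simp: Z_def T_def topY)
  then have exc: "hom_induced (int q) (subtopology Y (topspace Y - Z)) (T - Z) (subtopology Y (topspace Y)) T id
    \<in> iso (relative_homology_group (int q) (subtopology Y (topspace Y - Z)) (T - Z))
          (relative_homology_group (int q) (subtopology Y (topspace Y)) T)"
    using opT clZ
    by (intro homology_excision_axiom) (auto simp: closure_of_closedin interior_of_openin T_def)
  have ci: "continuous_map W A (\<lambda>p. (p, -1))"
    by (auto simp: A_def Y_def continuous_map_in_subtopology continuous_map_pairwise o_def Z_def)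
  have ii: "(\<lambda>p. (p, -1)) \<in> (topspace W - {x}) \<rightarrow> T - Z"
    by (auto simp: T_def Z_def topY)
  define cA where "cA = chain_map q (\<lambda>p. (p, -1::real)) c"
  have cA: "singular_relcycle q A (T - Z) cA"
    unfolding cA_def by (rule singular_relcycle_chain_map [OF c ci ii])
  have idA: "continuous_map A Y id"
    by (simp add: A_def continuous_map_from_subtopology)
  have "homologous_rel_set q A (T - Z) cA = singular_relboundary_set q A (T - Z)"
  proof -
    let ?h = "hom_induced (int q) A (T - Z) Y T id"
    let ?G = "relative_homology_group (int q) A (T - Z)"
    have inj: "inj_on ?h (carrier ?G)"
      using exc by (simp add: A_def iso_def bij_betw_def)
    have "?h (homologous_rel_set q A (T - Z) cA) = homologous_rel_set q Y T (chain_map q id cA)"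
      by (rule hom_induced_chain_map [OF idA _ cA]) auto
    also have "chain_map q id cA = cA"
      by (rule chain_map_ident [OF singular_relcycle_imp_chain [OF cA]])
    also have "homologous_rel_set q Y T cA = singular_relboundary_set q Y T"
      using bot unfolding T_def cA_def homologous_rel_set_eq_relboundary by simp
    \<comment> \<open>The class of the relative boundaries is the neutral element, which the induced
      homomorphism preserves.\<close>
    also have "\<dots> = ?h \<one>\<^bsub>?G\<^esub>"
      using hom_one [OF hom_induced_hom group_relative_homology_group group_relative_homology_group,
          of "int q" A "T - Z" Y T id] by simp
    finally have "homologous_rel_set q A (T - Z) cA = \<one>\<^bsub>?G\<^esub>"
    proof (rule inj_onD [OF inj])
      show "homologous_rel_set q A (T - Z) cA \<in> carrier ?G"
        unfolding carrier_relative_homology_group using cA by blast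
      show "\<one>\<^bsub>?G\<^esub> \<in> carrier ?G"
        by (rule monoid.one_closed [OF group.is_monoid [OF group_relative_homology_group]])
    qed
    then show ?thesis by simp
  qed
  then have "singular_relboundary q A (T - Z) cA"
    by (simp add: homologous_rel_set_eq_relboundary)
  moreover have "continuous_map A W fst"
    using cf by (simp add: A_def continuous_map_from_subtopology)
  moreover have "fst \<in> T - Z \<rightarrow> topspace W - {x}"
    by (auto simp: T_def Z_def topY)
  ultimately have "singular_relboundary q W (topspace W - {x}) (chain_map q fst cA)"
    by (rule singular_relboundary_chain_map)
  moreover have "chain_map q fst cA = c"
  proof -
    have "chain_map q fst cA = chain_map q (fst \<circ> (\<lambda>p. (p, -1::real))) c"
      unfolding cA_def chain_map_compose comp_apply ..
    also have "\<dots> = c"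
      by (rule chain_map_id_gen [OF singular_relcycle_imp_chain [OF c]]) simp
    finally show ?thesis .
  qed
  ultimately show ?thesis by simp
qed

text \<open>Summing the prisms over a relative cycle \<open>c\<close> gives a chain whose boundary
  is tops minus bottoms minus sides. The tops have positive height, and the sides lie over the
  boundary of \<open>c\<close>, hence off \<open>x\<close> by \<open>miss\<close>. So the bottoms
  form a relative boundary, and the excision argument applies.\<close>

lemma trivial_relative_homology_by_natural_homotopy:
  fixes W :: "'a topology"
    and H :: "nat \<Rightarrow> ((nat \<Rightarrow> real) \<Rightarrow> 'a) \<Rightarrow> (nat \<Rightarrow> real) \<times> real \<Rightarrow> 'a \<times> real"
  assumes clo: "closedin W {x}"
    and cont: "\<And>r \<sigma>. \<lbrakk>r \<le> q; singular_simplex r W \<sigma>\<rbrakk> \<Longrightarrow>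
        continuous_map (cyl r) (subtopology (prod_topology W euclideanreal) (- {(x, 0)})) (H r \<sigma>)"
    and bot: "\<And>\<sigma> p. \<lbrakk>singular_simplex q W \<sigma>; p \<in> standard_simplex q\<rbrakk> \<Longrightarrow> H q \<sigma> (p, 0) = (\<sigma> p, -1)"
    and top: "\<And>\<sigma> p. \<lbrakk>singular_simplex q W \<sigma>; p \<in> standard_simplex q\<rbrakk> \<Longrightarrow> snd (H q \<sigma> (p, 1)) > 0"
    and miss: "\<And>r \<sigma> z. \<lbrakk>r \<le> q; singular_simplex r W \<sigma>; x \<notin> \<sigma> ` standard_simplex r; z \<in> topspace (cyl r)\<rbrakk>
        \<Longrightarrow> fst (H r \<sigma> z) \<noteq> x"
    and nat: "\<And>\<sigma> k p t. \<lbrakk>0 < q; singular_simplex q W \<sigma>; k \<le> q; p \<in> standard_simplex (q - 1);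
               t \<in> {0..1}\<rbrakk> \<Longrightarrow> H (q - 1) (singular_face q k \<sigma>) (p, t) = H q \<sigma> (simplical_face k p, t)"
  shows "trivial_group (relative_homology_group (int q) W (topspace W - {x}))"
proof -
  let ?Y = "subtopology (prod_topology W euclideanreal) (- {(x, 0)})"
  let ?T = "{z. fst z \<noteq> x \<or> snd z > (0::real)}"
  obtain pr where pr: "\<And>q. is_prism q (pr (q - 1)) (pr q)"
    using prism_chains_exist by blast
  have prc: "singular_chain (Suc r) (cyl r) (pr r)" for r
    using pr [of r] by (simp add: is_prism_def)
  have "singular_relboundary q W (topspace W - {x}) c" if c: "singular_relcycle q W (topspace W - {x}) c" for c
  proof (rule relboundary_if_bottom_relboundary [OF c _ clo])
    have cW: "singular_chain q W c" and dc: "singular_chain (q - 1) (subtopology W (topspace W - {x})) (chain_boundary q c)"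
      using c by (auto simp: singular_relcycle)
    define d where "d = frag_extend (\<lambda>\<sigma>. chain_map (Suc q) (H q \<sigma>) (pr q)) c"
    define e1 where "e1 = frag_extend (\<lambda>\<sigma>. frag_of (restrict (\<lambda>p. H q \<sigma> (p, 1)) (standard_simplex q))) c"
    define e2 where "e2 = frag_extend (\<lambda>\<sigma>. chain_map q (H (q - 1) \<sigma>) (pr (q - 1))) (chain_boundary q c)"
    have cq: "\<sigma> \<in> Poly_Mapping.keys c \<Longrightarrow> singular_simplex q W \<sigma>" for \<sigma>
      using cW by (auto simp: singular_chain_def)
    have b: "frag_extend (\<lambda>\<sigma>. frag_of (restrict (\<lambda>p. H q \<sigma> (p, 0)) (standard_simplex q))) c
        = chain_map q (\<lambda>p. (p, -1)) c"
      unfolding chain_map_def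
      by (rule frag_extend_eq)
         (auto simp: simplex_map_def bot [OF cq] intro!: arg_cong [where f = frag_of] restrict_ext)
    have "chain_boundary (Suc q) d = e1 - chain_map q (\<lambda>p. (p, -1)) c - e2"
      unfolding d_def e1_def e2_def b [symmetric]
    proof (rule prism_boundary [OF pr _ _ cW])
      show "singular_chain q (cyl (q - 1)) (pr (q - 1))" if "0 < q"
        using prc [of "q - 1"] that by simp
    qed (rule nat)
    moreover have dY: "singular_chain (Suc q) ?Y d"
      unfolding d_def
      by (intro singular_chain_extend singular_chain_chain_map [OF prc] cont cq) auto
    moreover have "singular_chain q (subtopology ?Y ?T) e1"
      unfolding e1_def
    proof (rule singular_chain_extend)
      fix \<sigma> assume "\<sigma> \<in> Poly_Mapping.keys c"
      then have \<sigma>: "singular_simplex q W \<sigma>" by (rule cq)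
      have "continuous_map (simplex_space q) ?Y (H q \<sigma> \<circ> (\<lambda>p. (p, 1)))"
        by (rule continuous_map_compose [OF continuous_map_cyl_top cont]) (use \<sigma> in auto)
      then show "singular_chain q (subtopology ?Y ?T) (frag_of (restrict (\<lambda>p. H q \<sigma> (p, 1)) (standard_simplex q)))"
        using top [OF \<sigma>]
        by (auto simp: singular_chain_of singular_simplex_def o_def continuous_map_in_subtopology)
    qed
    moreover have "singular_chain q (subtopology ?Y ?T) e2"
    proof (cases "q = 0")
      case True
      then show ?thesis by (simp add: e2_def chain_boundary_def)
    next
      case False
      then have prq: "singular_chain q (cyl (q - 1)) (pr (q - 1))"
        using prc [of "q - 1"] by simp
      show ?thesis
        unfolding e2_def
      proof (rule singular_chain_extend)
        fix \<sigma> assume "\<sigma> \<in> Poly_Mapping.keys (chain_boundary q c)"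
        then have "singular_simplex (q - 1) (subtopology W (topspace W - {x})) \<sigma>"
          using dc by (auto simp: singular_chain_def)
        then have \<sigma>: "singular_simplex (q - 1) W \<sigma>" "x \<notin> \<sigma> ` standard_simplex (q - 1)"
          by (auto simp: singular_simplex_subtopology)
        have "continuous_map (cyl (q - 1)) (subtopology ?Y ?T) (H (q - 1) \<sigma>)"
          using cont [OF _ \<sigma>(1)] miss [OF _ \<sigma>] by (auto simp: continuous_map_in_subtopology Pi_iff)
        then show "singular_chain q (subtopology ?Y ?T) (chain_map q (H (q - 1) \<sigma>) (pr (q - 1)))"
          by (rule singular_chain_chain_map [OF prq])
      qed
    qed
    ultimately show "singular_relboundary q ?Y ?T (chain_map q (\<lambda>p. (p, -1)) c)"
      unfolding singular_relboundary_alt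
      \<comment> \<open>The boundary of \<open>-d\<close> is the bottom copy plus
        \<open>e2 - e1\<close>, and \<open>e2 - e1\<close> lies in \<open>?T\<close>.\<close>
      by (intro exI [of _ "-d"] exI [of _ "e2 - e1"])
         (simp add: singular_chain_minus singular_chain_diff chain_boundary_minus)
  qed
  then have *: "homologous_rel_set q W (topspace W - {x}) c = singular_relboundary_set q W (topspace W - {x})"
    if "singular_relcycle q W (topspace W - {x}) c" for c
    unfolding homologous_rel_set_eq_relboundary using that by this
  have "carrier (relative_homology_group (int q) W (topspace W - {x})) \<subseteq> {\<one>\<^bsub>relative_homology_group (int q) W (topspace W - {x})\<^esub>}"
    unfolding carrier_relative_homology_group one_relative_homology_group
    by (rule image_subsetI) (use * in simp)
  then show ?thesis
    by (simp only: group.trivial_group_subset [OF group_relative_homology_group])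
qed

section \<open>Extension over a collared cell\<close>

text \<open>\<open>v\<close> is the depth below \<open>B\<close> and \<open>Q\<close> pushes
  outwards: by time \<open>s\<close> every point of depth at most \<open>s\<close> has arrived in
  \<open>B\<close>. Points of depth above 1 need not arrive at all.\<close>

definition collar :: "'c topology \<Rightarrow> 'c set \<Rightarrow> ('c \<Rightarrow> real) \<Rightarrow> ('c \<times> real \<Rightarrow> 'c) \<Rightarrow> bool" where
  "collar T B v Q \<longleftrightarrow>
     closedin T B \<and> continuous_map T euclideanreal v \<and>
     continuous_map (prod_topology T unit_interval) T Q \<and>
     (\<forall>p \<in> topspace T. 0 \<le> v p \<and> Q (p, 0) = p) \<and>
     (\<forall>p \<in> B. v p = 0 \<and> (\<forall>s \<in> {0..1}. Q (p, s) = p)) \<and>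
     (\<forall>p \<in> topspace T. \<forall>s \<in> {0..1}. v p \<le> s \<longrightarrow> Q (p, s) \<in> B)"

text \<open>This says that \<open>F\<close> is closed in \<open>P\<close> and of large inductive
  dimension at most 0, in terms of closed subsets of \<open>P\<close> itself.\<close>

definition clopen_splits :: "'c topology \<Rightarrow> 'c set \<Rightarrow> bool" where
  "clopen_splits P F \<longleftrightarrow>
     (\<forall>C0 C1. closedin P C0 \<and> closedin P C1 \<and> disjnt C0 C1 \<longrightarrow>
        (\<exists>F0 F1. closedin P F0 \<and> closedin P F1 \<and> disjnt F0 F1 \<and> F = F0 \<union> F1 \<and>
           F \<inter> C0 \<subseteq> F0 \<and> F \<inter> C1 \<subseteq> F1))"

lemma clopen_splitsE:
  assumes "clopen_splits P F" "closedin P C0" "closedin P C1" "disjnt C0 C1"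
  obtains F0 F1 where "closedin P F0" "closedin P F1" "disjnt F0 F1" "F = F0 \<union> F1"
    "F \<inter> C0 \<subseteq> F0" "F \<inter> C1 \<subseteq> F1"
  using assms(1) [unfolded clopen_splits_def, rule_format, OF conjI [OF assms(2) conjI [OF assms(3,4)]]]
  by (elim exE conjE) (rule that)

section \<open>Thickening of compact sets and extension of maps\<close>

text \<open>A Lebesgue number of the one-set cover \<open>{U}\<close> of \<open>K\<close> serves as
  \<open>\<epsilon>\<close>.\<close>

lemma (in Metric_space) compactin_subset_openin_thickening:
  assumes "compactin mtopology K" "openin mtopology U" "K \<subseteq> U"
  shows "\<exists>\<epsilon>>0. \<forall>k \<in> K. \<forall>y \<in> M. d k y < \<epsilon> \<longrightarrow> y \<in> U"
proof -
  obtain \<epsilon> where "\<epsilon> > 0" and \<epsilon>: "\<And>k. k \<in> K \<Longrightarrow> mball k \<epsilon> \<subseteq> U"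
    using lebesgue_number [OF assms(1), of "{U}"] assms(2,3) by auto
  moreover have "K \<subseteq> M"
    using compactin_subset_topspace [OF assms(1)] by simp
  ultimately show ?thesis
    by (intro exI [of _ \<epsilon>]) (auto simp: subset_iff)
qed

lemma continuous_map_paste_closed:
  assumes "closedin X A" "closedin X B"
    and "continuous_map (subtopology X A) Y f" "continuous_map (subtopology X B) Y f"
  shows "continuous_map (subtopology X (A \<union> B)) Y f"
proof (rule pasting_lemma_closed [where I = "{A, B}" and T = id and f = "\<lambda>_. f"])
  have "(A \<union> B) \<inter> A = A" "(A \<union> B) \<inter> B = B" by blast+
  then show "continuous_map (subtopology (subtopology X (A \<union> B)) (id i)) Y f" if "i \<in> {A, B}" for i
    using that assms(3,4) by (auto simp only: subtopology_subtopology id_apply insert_iff empty_iff)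
  show "closedin (subtopology X (A \<union> B)) (id i)" if "i \<in> {A, B}" for i
    using that assms(1,2) by (auto intro: closedin_subset_topspace)
qed auto

lemma Tietze_extension_real:
  assumes "normal_space X" "closedin X S" "continuous_map (subtopology X S) euclideanreal f"
  shows "\<exists>g. continuous_map X euclideanreal g \<and> (\<forall>x \<in> S. g x = f x)"
proof (rule Tietze_extension_realinterval [OF assms(1,2) is_interval_univ UNIV_not_empty assms(3) subset_UNIV])
  fix g assume "continuous_map X euclideanreal g" "\<And>x. x \<in> S \<Longrightarrow> g x = f x"
  then show ?thesis by blast
qed

text \<open>After a Tietze extension \<open>w\<close> of \<open>u\<close>, \<open>F\<close> is split
  into a part \<open>F0\<close> containing the points of \<open>F \<inter> D\<close> with
  \<open>u < 0\<close> and a part \<open>F1\<close> containing those with \<open>u > 0\<close>.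
  Replacing \<open>w\<close> by a negative function on \<open>F0\<close> and a positive one on
  \<open>F1\<close> alters nothing on \<open>D\<close>, and a second Tietze extension
  finishes.\<close>

lemma avoid_zero_on_clopen_splitting_set:
  fixes u :: "'c \<Rightarrow> real"
  assumes P: "normal_space P" and D: "closedin P D" and F: "closedin P F" "clopen_splits P F"
    and u: "continuous_map (subtopology P D) euclideanreal u"
    and nz: "\<And>z. z \<in> D \<Longrightarrow> z \<in> F \<Longrightarrow> u z \<noteq> 0"
  obtains u' where "continuous_map P euclideanreal u'" "\<And>z. z \<in> D \<Longrightarrow> u' z = u z"
    "\<And>z. z \<in> F \<Longrightarrow> u' z \<noteq> 0"
proof -
  obtain w where w: "continuous_map P euclideanreal w" and wu: "\<And>z. z \<in> D \<Longrightarrow> w z = u z"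
    using Tietze_extension_real [OF P D u] by blast
  let ?C0 = "F \<inter> D \<inter> {z \<in> topspace P. w z \<in> {..0}}"
  let ?C1 = "F \<inter> D \<inter> {z \<in> topspace P. w z \<in> {0..}}"
  have "closedin P ?C0" "closedin P ?C1"
    by (intro closedin_Int D F closedin_continuous_map_preimage [OF w]; simp)+
  moreover have "disjnt ?C0 ?C1"
    using nz wu by (auto simp: disjnt_def)
  ultimately obtain F0 F1 where F01: "closedin P F0" "closedin P F1" "disjnt F0 F1" "F = F0 \<union> F1"
      and C: "F \<inter> ?C0 \<subseteq> F0" "F \<inter> ?C1 \<subseteq> F1"
    by (rule clopen_splitsE [OF F(2)])
  have FP: "F \<subseteq> topspace P" using F(1) closedin_subset by blast
  \<comment> \<open>The absolute value of \<open>w\<close>, with either sign, still vanishes at the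
    zeros of \<open>w\<close> in \<open>F\<close>. These avoid \<open>D\<close>, so a Urysohn
    function that is 0 on \<open>D\<close> and 1 there can be added.\<close>
  define E where "E = F \<inter> {z \<in> topspace P. w z \<in> {0}}"
  have "closedin P E"
    unfolding E_def by (intro closedin_Int F closedin_continuous_map_preimage [OF w]) simp
  moreover have "disjnt D E"
    using nz wu by (auto simp: E_def disjnt_def)
  ultimately obtain \<phi> where \<phi>: "continuous_map P (top_of_set {0..1::real}) \<phi>"
      and \<phi>D: "\<phi> ` D \<subseteq> {0}" and \<phi>E: "\<phi> ` E \<subseteq> {1}"
    using Urysohn_lemma [OF P D, of E 0 1] by auto
  have \<phi>': "continuous_map P euclideanreal \<phi>" and \<phi>0: "\<And>z. z \<in> topspace P \<Longrightarrow> 0 \<le> \<phi> z"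
    using \<phi> by (auto simp: continuous_map_in_subtopology)
  define f where "f z = (if z \<in> F0 then - \<bar>w z\<bar> - \<phi> z else if z \<in> F1 then \<bar>w z\<bar> + \<phi> z else w z)" for z
  have f0: "f z = - \<bar>w z\<bar> - \<phi> z" if "z \<in> F0" for z
    using that by (simp add: f_def)
  have f1: "f z = \<bar>w z\<bar> + \<phi> z" if "z \<in> F1" for z
    using that F01(3) by (auto simp: f_def disjnt_def)
  have fD: "f z = w z" if "z \<in> D" for z
  proof -
    have "\<phi> z = 0" "z \<in> topspace P" using \<phi>D that closedin_subset [OF D] by auto
    moreover have "w z \<le> 0" if "z \<in> F0"
    proof (rule ccontr)
      assume "\<not> w z \<le> 0"
      then have "z \<in> F \<inter> ?C1" using F01(4) that \<open>z \<in> D\<close> \<open>z \<in> topspace P\<close> by simp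
      then have "z \<in> F1" using C(2) by (rule rev_subsetD)
      then show False using F01(3) that by (simp add: disjnt_iff)
    qed
    moreover have "w z \<ge> 0" if "z \<in> F1"
    proof (rule ccontr)
      assume "\<not> w z \<ge> 0"
      then have "z \<in> F \<inter> ?C0" using F01(4) that \<open>z \<in> D\<close> \<open>z \<in> topspace P\<close> by simp
      then have "z \<in> F0" using C(1) by (rule rev_subsetD)
      then show False using F01(3) that by (simp add: disjnt_iff)
    qed
    ultimately show ?thesis by (auto simp: f_def)
  qed
  have "continuous_map (subtopology P D) euclideanreal f"
    using continuous_map_eq [OF continuous_map_from_subtopology [OF w, of D]] fD by simp
  moreover have "continuous_map (subtopology P F0) euclideanreal f"
    by (rule continuous_map_eq [where f = "\<lambda>z. - \<bar>w z\<bar> - \<phi> z"])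
       (auto simp: f0 intro!: continuous_intros continuous_map_from_subtopology w \<phi>')
  moreover have "continuous_map (subtopology P F1) euclideanreal f"
    by (rule continuous_map_eq [where f = "\<lambda>z. \<bar>w z\<bar> + \<phi> z"])
       (auto simp: f1 intro!: continuous_intros continuous_map_from_subtopology w \<phi>')
  ultimately have contf: "continuous_map (subtopology P (D \<union> (F0 \<union> F1))) euclideanreal f"
    using D F01 by (intro continuous_map_paste_closed closedin_Un)
  have "closedin P (D \<union> (F0 \<union> F1))"
    using D F01 by (intro closedin_Un)
  then obtain u' where u': "continuous_map P euclideanreal u'" "\<And>z. z \<in> D \<union> (F0 \<union> F1) \<Longrightarrow> u' z = f z"
    using Tietze_extension_real [OF P _ contf] by blast
  show ?thesis
  proof
    show "u' z = u z" if "z \<in> D" for z using u'(2) fD wu that by simp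
    show "u' z \<noteq> 0" if "z \<in> F" for z
    proof -
      have zP: "z \<in> topspace P" using FP that by blast
      have "\<bar>w z\<bar> + \<phi> z > 0"
      proof (cases "w z = 0")
        case True
        then show ?thesis using \<phi>E that zP by (auto simp: E_def)
      next
        case False
        then show ?thesis using \<phi>0 [OF zP] by simp
      qed
      then show ?thesis
        using u'(2) [of z] f0 f1 that F01(4) by fastforce
    qed
  qed (rule u')
qed

text \<open>Homotopy extension turns \<open>g\<close> and the first coordinate of \<open>Hb\<close>
  into a map \<open>h\<close> on the cylinder; \<open>approx\<close> perturbs it through
  \<open>G\<close> so that the final stage attains \<open>x\<close> only on a splitting set, where
  the height \<open>u\<close> can be kept nonzero. The collar absorbs the passage from
  \<open>h\<close> to the final stage, so that the boundary values are kept.\<close>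

lemma extend_over_collared_cell:
  fixes T :: "'c topology" and g :: "'c \<Rightarrow> 'a" and Hb :: "'c \<times> real \<Rightarrow> 'a \<times> real"
  defines "P \<equiv> prod_topology T unit_interval"
  assumes M: "Metric_space M d" and X: "X = Metric_space.mtopology M d"
    and U: "openin X U" and x: "x \<in> M"
    and T: "compact_space T" "Hausdorff_space T" and col: "collar T B v Q"
    and approx: "\<And>h \<epsilon>. \<lbrakk>continuous_map P X h; \<epsilon> > 0\<rbrakk> \<Longrightarrow>
        \<exists>G. continuous_map (prod_topology P unit_interval) X G \<and>
            (\<forall>z \<in> topspace P. G (z, 0) = h z \<and> (\<forall>s \<in> {0..1}. d (h z) (G (z, s)) < \<epsilon>)) \<and>
            clopen_splits P {z \<in> topspace P. G (z, 1) = x}"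
    and g: "continuous_map T (subtopology X U) g"
    and Hb: "continuous_map (subtopology P (B \<times> {0..1})) (prod_topology (subtopology X U) euclideanreal) Hb"
    and Hb0: "\<And>p. p \<in> B \<Longrightarrow> fst (Hb (p, 0)) = g p"
    and Hb_low: "\<And>p t. \<lbrakk>p \<in> B; 0 \<le> t; t \<le> 1/2\<rbrakk> \<Longrightarrow> snd (Hb (p, t)) = -1"
    and Hb1: "\<And>p. p \<in> B \<Longrightarrow> snd (Hb (p, 1)) = 1"
    and Hbx: "\<And>p t. \<lbrakk>p \<in> B; t \<in> {0..1}\<rbrakk> \<Longrightarrow> Hb (p, t) \<noteq> (x, 0)"
  obtains H where "continuous_map P (prod_topology (subtopology X U) euclideanreal) H"
    "\<And>p. p \<in> topspace T \<Longrightarrow> fst (H (p, 0)) = g p"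
    "\<And>p t. \<lbrakk>p \<in> topspace T; 0 \<le> t; t \<le> 1/2\<rbrakk> \<Longrightarrow> snd (H (p, t)) = -1"
    "\<And>p. p \<in> topspace T \<Longrightarrow> snd (H (p, 1)) = 1"
    "\<And>p t. \<lbrakk>p \<in> topspace T; t \<in> {0..1}\<rbrakk> \<Longrightarrow> H (p, t) \<noteq> (x, 0)"
    "\<And>p t. \<lbrakk>p \<in> B; t \<in> {0..1}\<rbrakk> \<Longrightarrow> H (p, t) = Hb (p, t)"
proof -
  interpret Metric_space M d by (rule M)
  have B: "closedin T B" and v: "continuous_map T euclideanreal v"
    and Q: "continuous_map P T Q"
    and v0: "\<And>p. p \<in> topspace T \<Longrightarrow> 0 \<le> v p" and Q0: "\<And>p. p \<in> topspace T \<Longrightarrow> Q (p, 0) = p"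
    and vB: "\<And>p. p \<in> B \<Longrightarrow> v p = 0" and QB: "\<And>p s. \<lbrakk>p \<in> B; s \<in> {0..1}\<rbrakk> \<Longrightarrow> Q (p, s) = p"
    and Qv: "\<And>p s. \<lbrakk>p \<in> topspace T; s \<in> {0..1}; v p \<le> s\<rbrakk> \<Longrightarrow> Q (p, s) \<in> B"
    using col unfolding collar_def P_def by auto
  have BT: "B \<subseteq> topspace T" using B closedin_subset by blast
  have topP: "topspace P = topspace T \<times> {0..1}" by (simp add: P_def)
  have compP: "compact_space P"
    using T by (simp add: P_def compact_space_prod_topology compact_space_subtopology)
  have "Hausdorff_space P"
    using T by (simp add: P_def Hausdorff_space_prod_topology Hausdorff_space_subtopology)
  with compP have normP: "normal_space P"
    by (simp add: compact_Hausdorff_or_regular_imp_normal_space)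
  have clB: "closedin P (B \<times> {0..1})"
    using B by (simp add: P_def closedin_prod_Times_iff)
  have cf: "continuous_map P T fst" and cs: "continuous_map P unit_interval snd"
    unfolding P_def by (rule continuous_map_fst continuous_map_snd)+
  have cs': "continuous_map P euclideanreal snd"
    by (rule continuous_map_into_fulltopology [OF cs])
  have cv: "continuous_map P euclideanreal (\<lambda>z. v (fst z))"
    using continuous_map_compose [OF cf v] by (simp add: o_def)
  have cpair: "continuous_map P P (\<lambda>z. (f z, h z))"
    if "continuous_map P T f" "continuous_map P euclideanreal h" "\<And>z. z \<in> topspace P \<Longrightarrow> h z \<in> {0..1}" for f h
    using that by (subst (2) P_def) (auto simp: continuous_map_pairwise o_def continuous_map_in_subtopology)

  \<comment> \<open>Homotopy extension along the retraction of the cylinder onto its bottom and sides.\<close>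
  define M0 where "M0 = B \<times> {0..1} \<union> topspace T \<times> {0::real}"
  define m where "m z = (if fst z \<in> B then fst (Hb z) else g (fst z))" for z
  have cm: "continuous_map (subtopology P M0) (subtopology X U) m"
    unfolding M0_def
  proof (rule continuous_map_paste_closed [OF clB])
    show "closedin P (topspace T \<times> {0})"
      by (simp add: P_def closedin_prod_Times_iff closedin_subtopology_refl)
    show "continuous_map (subtopology P (B \<times> {0..1})) (subtopology X U) m"
      by (rule continuous_map_eq [OF continuous_map_fst_of [OF Hb]]) (auto simp: m_def)
    have "continuous_map (subtopology P (topspace T \<times> {0})) (subtopology X U) (g \<circ> fst)"
      by (intro continuous_map_compose [OF _ g] continuous_map_from_subtopology cf)
    then show "continuous_map (subtopology P (topspace T \<times> {0})) (subtopology X U) m"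
      by (rule continuous_map_eq) (auto simp: m_def Hb0)
  qed
  \<comment> \<open>At time \<open>t\<close> a point of depth at most \<open>t\<close> has been
    pushed into \<open>B\<close> and lands on the side; a deeper one lands at height 0.\<close>
  define R where "R z = (Q z, max 0 (snd z - v (fst z)))" for z
  have cR: "continuous_map P (subtopology P M0) R"
  proof -
    have "continuous_map P P R"
      unfolding R_def
      by (intro cpair Q continuous_intros cs' cv) (use v0 in \<open>force simp: topP\<close>)+
    moreover have "R z \<in> M0" if zP: "z \<in> topspace P" for z
    proof -
      obtain p t where z: "z = (p, t)" "p \<in> topspace T" "t \<in> {0..1}"
        using zP topP by (cases z) simp
      have "Q (p, t) \<in> topspace T"
        using Q zP z(1) by (auto simp: continuous_map_def)
      then show ?thesis
        using Qv [OF z(2,3)] v0 [OF z(2)] z by (cases "v p \<le> t") (auto simp: R_def M0_def)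
    qed
    ultimately show ?thesis by (auto simp: continuous_map_in_subtopology)
  qed
  define h where "h = m \<circ> R"
  have ch: "continuous_map P (subtopology X U) h"
    unfolding h_def by (rule continuous_map_compose [OF cR cm])
  have hB: "h (p, t) = fst (Hb (p, t))" if "p \<in> B" "t \<in> {0..1}" for p t
    using that by (simp add: h_def R_def m_def QB vB)
  have h0: "h (p, 0) = g p" if "p \<in> topspace T" for p
    using that v0 [OF that] by (simp add: h_def R_def m_def Q0 Hb0)
  have chX: "continuous_map P X h" and hU: "\<And>z. z \<in> topspace P \<Longrightarrow> h z \<in> U"
    using ch by (auto simp: continuous_map_in_subtopology)

  \<comment> \<open>The bound \<open>\<epsilon>1\<close> keeps perturbations of \<open>h\<close>
    inside \<open>U\<close>.\<close>
  have "\<exists>\<epsilon>>0. \<forall>k \<in> h ` topspace P. \<forall>y \<in> M. d k y < \<epsilon> \<longrightarrow> y \<in> U"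
  proof (rule compactin_subset_openin_thickening)
    show "compactin mtopology (h ` topspace P)"
      using image_compactin [OF _ chX] compP X by (simp add: compact_space_def)
    show "openin mtopology U" using U X by simp
  qed (use hU in auto)
  then obtain \<epsilon>1 where \<epsilon>1: "\<epsilon>1 > 0" "\<And>k y. \<lbrakk>k \<in> h ` topspace P; y \<in> M; d k y < \<epsilon>1\<rbrakk> \<Longrightarrow> y \<in> U"
    by metis
  \<comment> \<open>On the side the only danger is height 0. On the compact set \<open>K\<close>
    where it occurs \<open>h\<close> avoids \<open>x\<close>, so a bound \<open>\<epsilon>2\<close>
    makes every stage of the perturbation avoid \<open>x\<close> there.\<close>
  define K where "K = {z \<in> B \<times> {0..1}. snd (Hb z) = 0}"
  have KP: "K \<subseteq> topspace P" using BT by (auto simp: K_def topP)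
  have "closedin (subtopology P (B \<times> {0..1})) {z \<in> topspace (subtopology P (B \<times> {0..1})). snd (Hb z) \<in> {0}}"
    using closedin_continuous_map_preimage [OF continuous_map_snd_of [OF Hb], of "{0}"] by (simp add: o_def)
  moreover have "{z \<in> topspace (subtopology P (B \<times> {0..1})). snd (Hb z) \<in> {0}} = K"
    using BT by (auto simp: K_def topP)
  ultimately have clK: "closedin P K"
    using closedin_closed_subtopology [OF clB] by auto
  have "\<exists>\<epsilon>>0. \<forall>k \<in> h ` K. \<forall>y \<in> M. d k y < \<epsilon> \<longrightarrow> y \<in> M - {x}"
  proof (rule compactin_subset_openin_thickening)
    show "compactin mtopology (h ` K)"
      using image_compactin [OF closedin_compact_space [OF compP clK] chX] X by simp
    show "openin mtopology (M - {x})"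
      using x by (metis closedin_def closedin_t1_singleton Hausdorff_imp_t1_space Hausdorff_space_mtopology topspace_mtopology)
    show "h ` K \<subseteq> M - {x}"
    proof clarify
      fix p t assume pt: "(p, t) \<in> K"
      then have "h (p, t) \<in> M" using chX KP X by (auto simp: continuous_map_def)
      moreover have "h (p, t) \<noteq> x"
        using pt Hbx [of p t] hB [of p t] by (auto simp: K_def prod_eq_iff)
      ultimately show "h (p, t) \<in> M - {x}" by simp
    qed
  qed
  then obtain \<epsilon>2 where \<epsilon>2: "\<epsilon>2 > 0" "\<And>k y. \<lbrakk>k \<in> h ` K; y \<in> M; d k y < \<epsilon>2\<rbrakk> \<Longrightarrow> y \<in> M - {x}"
    by blast
  obtain G where G: "continuous_map (prod_topology P unit_interval) X G"
    and G0: "\<And>z. z \<in> topspace P \<Longrightarrow> G (z, 0) = h z"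
    and Gd: "\<And>z s. \<lbrakk>z \<in> topspace P; s \<in> {0..1}\<rbrakk> \<Longrightarrow> d (h z) (G (z, s)) < min \<epsilon>1 \<epsilon>2"
    and Gsplit: "clopen_splits P {z \<in> topspace P. G (z, 1) = x}"
    using approx [OF chX, of "min \<epsilon>1 \<epsilon>2"] \<epsilon>1(1) \<epsilon>2(1) by auto
  have GM: "G (z, s) \<in> M" if "z \<in> topspace P" "s \<in> {0..1}" for z s
    using G that X by (auto simp: continuous_map_def Pi_iff)
  have GU: "G (z, s) \<in> U" if "z \<in> topspace P" "s \<in> {0..1}" for z s
    using \<epsilon>1(2) [OF imageI [OF that(1)] GM [OF that]] Gd [OF that] by simp
  have Gx: "G (z, s) \<noteq> x" if "z \<in> K" "s \<in> {0..1}" for z s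
  proof -
    have zP: "z \<in> topspace P" using KP that(1) by blast
    have "d (h z) (G (z, s)) < \<epsilon>2" using Gd [OF zP that(2)] by simp
    then show ?thesis using \<epsilon>2(2) [OF imageI [OF that(1)] GM [OF zP that(2)]] by simp
  qed

  define F where "F = {z \<in> topspace P. G (z, 1) = x}"
  have clF: "closedin P F"
  proof -
    have "continuous_map P (prod_topology P unit_interval) (\<lambda>z. (z, 1))"
      by (simp add: continuous_map_pairwise o_def)
    then have "continuous_map P X (G \<circ> (\<lambda>z. (z, 1)))"
      using G continuous_map_compose by blast
    moreover have "closedin X {x}"
      using x X by (metis closedin_t1_singleton Hausdorff_imp_t1_space Hausdorff_space_mtopology topspace_mtopology)
    ultimately have "closedin P {z \<in> topspace P. (G \<circ> (\<lambda>z. (z, 1))) z \<in> {x}}"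
      by (rule closedin_continuous_map_preimage)
    then show ?thesis by (simp add: F_def)
  qed
  \<comment> \<open>The height is prescribed on the side, on the lower half and at the top; the
    constant -1 up to time 1/2 leaves time to phase in the perturbation.\<close>
  define D where "D = B \<times> {0..1} \<union> (topspace T \<times> {0..1/2} \<union> topspace T \<times> {1::real})"
  have cl1: "closedin P (topspace T \<times> {0..1/2})" and cl2: "closedin P (topspace T \<times> {1})"
    by (auto simp: P_def closedin_prod_Times_iff intro!: closedin_subset_topspace)
  have clD: "closedin P D"
    unfolding D_def by (intro closedin_Un clB cl1 cl2)
  define f :: "'c \<times> real \<Rightarrow> real" where "f z = (if fst z \<in> B then snd (Hb z) else if snd z \<le> 1/2 then -1 else 1)" for z
  have cfD: "continuous_map (subtopology P D) euclideanreal f"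
    unfolding D_def
  proof (intro continuous_map_paste_closed clB cl1 cl2 closedin_Un)
    show "continuous_map (subtopology P (B \<times> {0..1})) euclideanreal f"
      by (rule continuous_map_eq [OF continuous_map_snd_of [OF Hb]]) (auto simp: f_def)
    show "continuous_map (subtopology P (topspace T \<times> {0..1/2})) euclideanreal f"
      by (rule continuous_map_eq [where f = "\<lambda>_. -1"]) (auto simp: f_def Hb_low)
    show "continuous_map (subtopology P (topspace T \<times> {1})) euclideanreal f"
      by (rule continuous_map_eq [where f = "\<lambda>_. 1"]) (auto simp: f_def Hb1)
  qed
  \<comment> \<open>The prescribed height vanishes only on \<open>K\<close>, where the final stage
    of \<open>G\<close> misses \<open>x\<close>.\<close>
  have fnz: "f z \<noteq> 0" if "z \<in> D" "z \<in> F" for z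
  proof
    assume "f z = 0"
    then have "z \<in> K"
      using that by (auto simp: f_def D_def K_def F_def topP split: if_splits)
    then show False using Gx [of z 1] that(2) by (auto simp: F_def)
  qed
  obtain u where u: "continuous_map P euclideanreal u" and uD: "\<And>z. z \<in> D \<Longrightarrow> u z = f z"
      and uF: "\<And>z. z \<in> F \<Longrightarrow> u z \<noteq> 0"
    using avoid_zero_on_clopen_splitting_set [OF normP clD clF _ cfD fnz] Gsplit F_def by blast

  \<comment> \<open>For \<open>t \<ge> 1/2\<close> the outer part of the collar runs through the homotopy \<open>G\<close> over the boundary,
    and the inner part carries its final stage; for \<open>t \<le> 1/2\<close> this is phased in.\<close>
  define a where "a t = min 1 (2 * t)" for t :: real
  define \<rho> :: "'c \<times> real \<Rightarrow> ('c \<times> real) \<times> real" where "\<rho> z = ((Q (fst z, a (snd z)), snd z), a (snd z) * min 1 (v (fst z)))" for z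
  \<comment> \<open>The height uses the full push at every time: up to time 1/2 it is constantly -1,
    so nothing has to be phased in.\<close>
  define \<kappa> :: "'c \<times> real \<Rightarrow> 'c \<times> real" where "\<kappa> z = (Q (fst z, 1), snd z)" for z
  define H :: "'c \<times> real \<Rightarrow> 'a \<times> real" where "H z = (G (\<rho> z), u (\<kappa> z))" for z
  have ca: "continuous_map P euclideanreal (\<lambda>z. a (snd z))"
    unfolding a_def by (intro continuous_intros cs')
  have a01: "a t \<in> {0..1}" if "t \<in> {0..1}" for t using that by (auto simp: a_def)
  have cQa: "continuous_map P T (\<lambda>z. Q (fst z, a (snd z)))"
    using continuous_map_compose [OF cpair [OF cf ca] Q] a01 by (auto simp: topP o_def)
  have cQ1: "continuous_map P T (\<lambda>z. Q (fst z, 1))"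
    using continuous_map_compose [OF cpair [OF cf] Q, of "\<lambda>_. 1"] by (auto simp: o_def)
  have av: "a (snd z) * min 1 (v (fst z)) \<in> {0..1}" if "z \<in> topspace P" for z
    using a01 [of "snd z"] v0 [of "fst z"] that by (auto simp: topP mult_le_one)
  have c\<rho>: "continuous_map P (prod_topology P unit_interval) \<rho>"
    unfolding \<rho>_def continuous_map_pairwise o_def fst_conv snd_conv
    using av by (intro conjI cpair cQa cs')
      (auto simp: continuous_map_in_subtopology topP intro!: continuous_intros ca cv)
  have c\<kappa>: "continuous_map P P \<kappa>"
    unfolding \<kappa>_def by (intro cpair cQ1 cs') (auto simp: topP)
  have \<kappa>D: "\<kappa> (p, t) \<in> topspace T \<times> {t}" if "p \<in> topspace T" "t \<in> {0..1}" for p t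
    using c\<kappa> that by (auto simp: continuous_map_def \<kappa>_def topP Pi_iff)
  have \<rho>P: "fst (\<rho> z) \<in> topspace P" "snd (\<rho> z) \<in> {0..1}" if "z \<in> topspace P" for z
    using c\<rho> that by (auto simp: continuous_map_def Pi_iff mem_Times_iff)
  show ?thesis
  proof
    have "continuous_map P (subtopology X U) (\<lambda>z. G (\<rho> z))"
      using continuous_map_compose [OF c\<rho> G] GU \<rho>P
      by (auto simp: continuous_map_in_subtopology o_def) (metis prod.collapse)
    then show "continuous_map P (prod_topology (subtopology X U) euclideanreal) H"
      using continuous_map_compose [OF c\<kappa> u] by (auto simp: continuous_map_pairwise o_def H_def)
    show "fst (H (p, 0)) = g p" if "p \<in> topspace T" for p
      using that by (simp add: H_def \<rho>_def a_def Q0 G0 topP h0)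
    show "H (p, t) = Hb (p, t)" if "p \<in> B" "t \<in> {0..1}" for p t
      using that BT a01 [of t] uD [of "(p, t)"]
      by (auto simp: H_def \<rho>_def \<kappa>_def QB vB G0 topP hB D_def f_def prod_eq_iff)
    show low: "snd (H (p, t)) = -1" if "p \<in> topspace T" "0 \<le> t" "t \<le> 1/2" for p t
    proof -
      have "\<kappa> (p, t) \<in> D" using \<kappa>D [of p t] that by (auto simp: D_def)
      then show ?thesis using that by (auto simp: H_def uD f_def \<kappa>_def Hb_low)
    qed
    show "snd (H (p, 1)) = 1" if "p \<in> topspace T" for p
    proof -
      have "\<kappa> (p, 1) \<in> D" using \<kappa>D [of p 1] that by (auto simp: D_def)
      then show ?thesis using that by (auto simp: H_def uD f_def \<kappa>_def Hb1)
    qed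
    show "H (p, t) \<noteq> (x, 0)" if p: "p \<in> topspace T" and t: "t \<in> {0..1}" for p t
    proof
      assume "H (p, t) = (x, 0)"
      then have Gz: "G (\<rho> (p, t)) = x" and uz: "u (\<kappa> (p, t)) = 0"
        by (auto simp: H_def)
      \<comment> \<open>Up to time 1/2 the height is -1, so only times with \<open>a t = 1\<close>
        remain.\<close>
      have "t > 1/2"
      proof (rule ccontr)
        assume "\<not> t > 1/2"
        then have "snd (H (p, t)) = -1" using low p t by auto
        then show False using uz by (simp add: H_def)
      qed
      then have "a t = 1" by (simp add: a_def)
      then have Gz': "G (\<kappa> (p, t), min 1 (v p)) = x"
        using Gz by (simp add: \<rho>_def \<kappa>_def)
      have zP: "\<kappa> (p, t) \<in> topspace P" using \<kappa>D [OF p t] t topP by auto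
      show False
      \<comment> \<open>Within depth 1 the push ends in \<open>B\<close>, so height 0 puts the point
        in \<open>K\<close>, where no stage of \<open>G\<close> hits \<open>x\<close>. Deeper points
        see the final stage of \<open>G\<close>, and \<open>u\<close> has no zero on
        \<open>F\<close>.\<close>
      proof (cases "v p \<le> 1")
        case True
        then have "Q (p, 1) \<in> B" using Qv [OF p] by simp
        then have "\<kappa> (p, t) \<in> K"
          using uz uD [of "\<kappa> (p, t)"] t by (auto simp: \<kappa>_def D_def f_def K_def)
        then show False using Gx Gz' v0 [OF p] by auto
      next
        case False
        then have "\<kappa> (p, t) \<in> F" using Gz' zP by (simp add: F_def)
        then show False using uF uz by blast
      qed
    qed
  qed
qed

section \<open>Radial collar of the boundary of a simplex\<close>

definition simplex_boundary :: "nat \<Rightarrow> (nat \<Rightarrow> real) set" where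
  "simplex_boundary q = {p \<in> standard_simplex q. \<exists>i\<le>q. p i = 0}"

lemma continuous_map_Min:
  fixes f :: "'i \<Rightarrow> 'a \<Rightarrow> real"
  assumes "finite I" "I \<noteq> {}" "\<And>i. i \<in> I \<Longrightarrow> continuous_map X euclideanreal (f i)"
  shows "continuous_map X euclideanreal (\<lambda>x. Min ((\<lambda>i. f i x) ` I))"
  using assms
proof (induction I rule: finite_ne_induct)
  case (insert i I)
  then have "continuous_map X euclideanreal (\<lambda>x. min (f i x) (Min ((\<lambda>i. f i x) ` I)))"
    by (intro continuous_intros) auto
  then show ?case using insert.hyps by simp
qed auto

lemma standard_simplexI:
  assumes "\<And>i. i \<le> q \<Longrightarrow> 0 \<le> p i" "\<And>i. i > q \<Longrightarrow> p i = 0" "(\<Sum>i\<le>q. p i) = 1"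
  shows "p \<in> standard_simplex q"
proof -
  have "p i \<le> 1" if "i \<le> q" for i
    using member_le_sum [of i "{..q}" p] assms that by auto
  moreover have "p i = 0 \<or> i \<le> q" for i using assms(2) [of i] by linarith
  ultimately show ?thesis
    using assms unfolding standard_simplex_def by (smt (verit) mem_Collect_eq)
qed

text \<open>A measure of depth: on the simplex it vanishes exactly on the boundary and is largest at
  the barycentre.\<close>

definition coord_min :: "nat \<Rightarrow> (nat \<Rightarrow> real) \<Rightarrow> real" where
  "coord_min q p = Min (p ` {..q})"

text \<open>Projects radially from the barycentre, by an amount growing with the time \<open>snd z\<close>;
  at time 1 the outer half of the simplex has been pushed into the boundary.\<close>
definition push_out :: "nat \<Rightarrow> (nat \<Rightarrow> real) \<times> real \<Rightarrow> nat \<Rightarrow> real" where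
  "push_out q z = (let m = min (coord_min q (fst z)) (snd z / (2 * (real q + 1)))
     in (\<lambda>i. if i \<le> q then (fst z i - m) / (1 - (real q + 1) * m) else 0))"

text \<open>Subtracting the same \<open>m\<close> from all coordinates and renormalising by
  \<open>1 - (q + 1) m\<close> stays in the simplex, and lands in the boundary as soon as
  \<open>m\<close> is the smallest coordinate. The factor \<open>2 (q + 1)\<close> turns "depth at
  most \<open>s\<close>" into exactly that condition at time \<open>s\<close>.\<close>

lemma collar_standard_simplex:
  "collar (simplex_space q) (simplex_boundary q) (\<lambda>p. 2 * (real q + 1) * coord_min q p) (push_out q)"
proof -
  have cm_le: "coord_min q p \<le> p i" if "i \<le> q" for p i
    using that by (simp add: coord_min_def)
  have cm_ex: "\<exists>i\<le>q. coord_min q p = p i" for p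
  proof -
    have "Min (p ` {..q}) \<in> p ` {..q}" by (rule Min_in) auto
    then show ?thesis unfolding coord_min_def image_iff by blast
  qed
  have nonneg: "0 \<le> p i" if "p \<in> standard_simplex q" for p i
    using that by (simp add: standard_simplex_def)
  have cm0: "0 \<le> coord_min q p" if "p \<in> standard_simplex q" for p
    using cm_ex [of p] nonneg [OF that] by auto
  have cont_cm: "continuous_map X euclideanreal (\<lambda>x. coord_min q (f x))"
    if "\<And>i. continuous_map X euclideanreal (\<lambda>x. f x i)" for X and f :: "'x \<Rightarrow> nat \<Rightarrow> real"
    unfolding coord_min_def using that by (intro continuous_map_Min) auto
  have cont_coord: "continuous_map (simplex_space q) euclideanreal (\<lambda>p. p i)" for i
    by (intro continuous_map_from_subtopology continuous_map_product_projection) simp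
  define \<mu> where "\<mu> z = min (coord_min q (fst z)) (snd z / (2 * (real q + 1)))" for z :: "(nat \<Rightarrow> real) \<times> real"
  \<comment> \<open>The time-dependent cap on \<open>\<mu>\<close> keeps the denominator of
    \<open>push_out\<close> at least 1/2.\<close>
  have \<mu>: "0 \<le> \<mu> z" "(real q + 1) * \<mu> z \<le> 1/2" "i \<le> q \<Longrightarrow> \<mu> z \<le> fst z i"
    if "z \<in> standard_simplex q \<times> {0..1}" for z i
  proof -
    show "0 \<le> \<mu> z" using that cm0 by (auto simp: \<mu>_def)
    have "(real q + 1) * \<mu> z \<le> (real q + 1) * (snd z / (2 * (real q + 1)))"
      by (intro mult_left_mono) (auto simp: \<mu>_def)
    also have "\<dots> = snd z / 2" by (simp add: field_simps)
    also have "\<dots> \<le> 1/2" using that by auto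
    finally show "(real q + 1) * \<mu> z \<le> 1/2" .
    show "\<mu> z \<le> fst z i" if "i \<le> q" using cm_le [OF that, of "fst z"] by (simp add: \<mu>_def min_le_iff_disj)
  qed
  have push: "push_out q z = (\<lambda>i. if i \<le> q then (fst z i - \<mu> z) / (1 - (real q + 1) * \<mu> z) else 0)" for z
    unfolding push_out_def \<mu>_def Let_def ..
  have push_id: "push_out q z = fst z" if "\<mu> z = 0" "fst z \<in> standard_simplex q" for z
    using that by (auto simp: push standard_simplex_def)
  have push_in: "push_out q z \<in> standard_simplex q" if z: "z \<in> standard_simplex q \<times> {0..1}" for z
  proof (rule standard_simplexI)
    note \<mu>z = \<mu> [OF z]
    show "0 \<le> push_out q z i" if "i \<le> q" for i
      using \<mu>z(2) \<mu>z(3) [OF that] that by (simp add: push)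
    have "(\<Sum>i\<le>q. push_out q z i) = (\<Sum>i\<le>q. fst z i - \<mu> z) / (1 - (real q + 1) * \<mu> z)"
      by (simp add: push sum_divide_distrib)
    also have "(\<Sum>i\<le>q. fst z i - \<mu> z) = 1 - (real q + 1) * \<mu> z"
      using z by (auto simp: sum_subtractf standard_simplex_def)
    finally show "(\<Sum>i\<le>q. push_out q z i) = 1"
      using \<mu>z(2) by simp
  qed (simp add: push)
  have B0: "coord_min q p = 0 \<longleftrightarrow> p \<in> simplex_boundary q" if "p \<in> standard_simplex q" for p
    using cm_ex [of p] cm_le [of _ p] cm0 [OF that] that unfolding simplex_boundary_def
    by auto (metis order_antisym)
  have cont_cm': "continuous_map (simplex_space q) euclideanreal (coord_min q)"
    using cont_cm [of "simplex_space q" "\<lambda>p. p"] cont_coord by simp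
  have "{p \<in> topspace (simplex_space q). coord_min q p \<in> {0}} = simplex_boundary q"
    using B0 by (auto simp: simplex_boundary_def)
  then have clB: "closedin (simplex_space q) (simplex_boundary q)"
    using closedin_continuous_map_preimage [OF cont_cm', of "{0}"] by simp
  let ?P = "prod_topology (simplex_space q) unit_interval"
  have cfst: "continuous_map ?P euclideanreal (\<lambda>z. fst z i)" for i
    using continuous_map_compose [OF continuous_map_fst cont_coord] by (simp add: o_def)
  have csnd: "continuous_map ?P euclideanreal snd"
    by (rule continuous_map_into_fulltopology [OF continuous_map_snd])
  have c\<mu>: "continuous_map ?P euclideanreal \<mu>"
    unfolding \<mu>_def by (intro continuous_intros cont_cm cfst csnd) auto
  have cpush: "continuous_map ?P (simplex_space q) (push_out q)"
  proof -
    have "continuous_map ?P euclideanreal (\<lambda>z. push_out q z i)" for i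
    proof (cases "i \<le> q")
      case True
      have "1 - (real q + 1) * \<mu> z \<noteq> 0" if "z \<in> topspace ?P" for z
        using \<mu>(2) [of z] that by auto
      then show ?thesis
        using True by (simp add: push) (intro continuous_intros cfst c\<mu>; auto)
    qed (simp add: push)
    then show ?thesis
      using push_in by (auto simp: continuous_map_in_subtopology continuous_map_componentwise_UNIV)
  qed
  have "push_out q (p, s) \<in> simplex_boundary q"
    if p: "p \<in> standard_simplex q" and s: "s \<in> {0..1}" and le: "2 * (real q + 1) * coord_min q p \<le> s" for p s
  proof -
    obtain i where i: "i \<le> q" "coord_min q p = p i" using cm_ex by blast
    have "coord_min q p \<le> s / (2 * (real q + 1))"
      using le by (simp add: field_simps)
    then have "\<mu> (p, s) = p i" using i by (simp add: \<mu>_def)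
    then show ?thesis using push_in [of "(p, s)"] p s i(1) by (auto simp: simplex_boundary_def push)
  qed
  moreover have "push_out q (p, s) = p" if "p \<in> simplex_boundary q" "s \<in> {0..1}" for p s
  proof -
    have p: "p \<in> standard_simplex q" using that by (simp add: simplex_boundary_def)
    then show ?thesis using push_id [of "(p, s)"] B0 [OF p] that by (simp add: \<mu>_def)
  qed
  moreover have "push_out q (p, 0) = p" if "p \<in> standard_simplex q" for p
    using push_id [of "(p, 0)"] cm0 [OF that] that by (simp add: \<mu>_def)
  moreover have "coord_min q p = 0" if "p \<in> simplex_boundary q" for p
    using B0 that by (simp add: simplex_boundary_def)
  ultimately show ?thesis
    unfolding collar_def using clB cpush cm0 cont_cm'
    by (auto intro!: continuous_intros)
qed

section \<open>Approximation on cylinders over simplices\<close>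

text \<open>The preimages under \<open>r\<close> of the complements of \<open>C0\<close> and
  \<open>C1\<close> cover \<open>\<Phi>\<close>. A disjoint open refinement, grouped into two
  unions, cuts \<open>\<Phi>\<close> into two clopen parts, which are pulled back along the
  embedding \<open>e\<close>.\<close>

lemma covdim_le_0_imp_clopen_splits:
  assumes cov: "covdim_le_0 (subtopology S \<Phi>)" and cl: "closedin S \<Phi>"
    and e: "continuous_map P S e" and r: "continuous_map S P r"
    and re: "\<And>z. z \<in> topspace P \<Longrightarrow> r (e z) = z"
  shows "clopen_splits P {z \<in> topspace P. e z \<in> \<Phi>}"
  unfolding clopen_splits_def
proof (intro allI impI, elim conjE)
  fix C0 C1 assume C: "closedin P C0" "closedin P C1" "disjnt C0 C1"
  let ?T = "subtopology S \<Phi>"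
  have \<Phi>S: "\<Phi> \<subseteq> topspace S" using cl closedin_subset by blast
  then have topT: "topspace ?T = \<Phi>" by auto
  have cr: "continuous_map ?T P r" using r by (rule continuous_map_from_subtopology)
  define A where "A C = {y \<in> topspace ?T. r y \<in> topspace P - C}" for C
  have opA: "openin ?T (A C)" if "closedin P C" for C
    unfolding A_def using that by (intro openin_continuous_map_preimage [OF cr]) auto
  have rP: "r y \<in> topspace P" if "y \<in> \<Phi>" for y
    using cr topT that by (auto simp: continuous_map_def)
  have "\<Union>{A C0, A C1} = topspace ?T"
    using C(3) rP topT by (auto simp: A_def disjnt_iff)
  then obtain \<V> where \<V>: "\<forall>V\<in>\<V>. openin ?T V" "\<Union>\<V> = topspace ?T" "pairwise disjnt \<V>"
      "\<forall>V\<in>\<V>. \<exists>U\<in>{A C0, A C1}. V \<subseteq> U"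
    using cov [unfolded covdim_le_0_def, rule_format, of "{A C0, A C1}"] opA C by auto
  \<comment> \<open>Members whose image under \<open>r\<close> misses \<open>C0\<close> go to
    \<open>V1\<close>. Every other member lies in \<open>A C1\<close>, so \<open>V0\<close> receives
    the part over \<open>C0\<close>.\<close>
  define V1 where "V1 = \<Union>{V \<in> \<V>. V \<subseteq> A C0}"
  define V0 where "V0 = \<Union>{V \<in> \<V>. \<not> V \<subseteq> A C0}"
  have op: "openin ?T V0" "openin ?T V1"
    using \<V>(1) by (auto simp: V0_def V1_def intro!: openin_Union)
  have un: "V0 \<union> V1 = \<Phi>"
    using \<V>(2) topT by (auto simp: V0_def V1_def)
  have dis: "disjnt V0 V1"
    using \<V>(3) by (fastforce simp: V0_def V1_def pairwise_def disjnt_iff)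
  have "topspace ?T - V0 = V1" "topspace ?T - V1 = V0"
    using un dis topT by (auto simp: disjnt_iff)
  then have "closedin ?T V0" "closedin ?T V1"
    using op by (metis openin_closedin_eq openin_subset double_diff subset_refl closedin_def)+
  then have clV: "closedin S V0" "closedin S V1"
    using cl closedin_trans_full by blast+
  have V1: "V1 \<subseteq> A C0" and V0: "V0 \<subseteq> A C1"
    using \<V>(4) by (auto simp: V0_def V1_def)
  let ?F = "\<lambda>V. {z \<in> topspace P. e z \<in> V}"
  show "\<exists>F0 F1. closedin P F0 \<and> closedin P F1 \<and> disjnt F0 F1 \<and> ?F \<Phi> = F0 \<union> F1 \<and>
           ?F \<Phi> \<inter> C0 \<subseteq> F0 \<and> ?F \<Phi> \<inter> C1 \<subseteq> F1"
  proof (intro exI conjI)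
    show "closedin P (?F V0)" "closedin P (?F V1)"
      using clV by (auto intro: closedin_continuous_map_preimage [OF e])
    show "disjnt (?F V0) (?F V1)" using dis by (auto simp: disjnt_iff)
    show "?F \<Phi> = ?F V0 \<union> ?F V1" using un by auto
    show "?F \<Phi> \<inter> C0 \<subseteq> ?F V0"
      using V1 un re by (fastforce simp: A_def)
    show "?F \<Phi> \<inter> C1 \<subseteq> ?F V1"
      using V0 un re by (fastforce simp: A_def)
  qed
qed

section \<open>Cylinders over simplices as retracts of the cube\<close>

lemma topspace_cube: "topspace (cube n) = {..<n} \<rightarrow>\<^sub>E {0..1}"
  by (simp add: cube_def)

text \<open>On the simplex the barycentric coordinate \<open>q\<close> is determined by the others,
  so slot \<open>q\<close> is free for the height; the \<open>q + 1\<close> slots used fit into the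
  \<open>n\<close>-cube when \<open>q < n\<close>.\<close>

definition to_cube :: "nat \<Rightarrow> nat \<Rightarrow> (nat \<Rightarrow> real) \<times> real \<Rightarrow> nat \<Rightarrow> real" where
  "to_cube n q z = restrict (\<lambda>i. if i < q then fst z i else if i = q then snd z else 0) {..<n}"

text \<open>Dividing by \<open>s\<close> brings the sum of the first \<open>q\<close> coordinates
  down to at most 1 and changes nothing where it already is; hence, for \<open>q < n\<close>, this
  inverts \<open>to_cube n q\<close> on the cylinder.\<close>

definition from_cube :: "nat \<Rightarrow> (nat \<Rightarrow> real) \<Rightarrow> (nat \<Rightarrow> real) \<times> real" where
  "from_cube q y = (let s = max 1 (\<Sum>l<q. y l) in
     (\<lambda>i. if i < q then y i / s else if i = q then 1 - (\<Sum>l<q. y l / s) else 0, y q))"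

lemma continuous_map_to_cube:
  "continuous_map (cyl q) (cube n) (to_cube n q)"
proof -
  have id: "continuous_map (cyl q) (cyl q) (\<lambda>z. z)" by simp
  have "continuous_map (cyl q) (top_of_set {0..1}) (\<lambda>z. to_cube n q z i)" if "i < n" for i
    using id [unfolded continuous_map_cyl_iff] that
    by (auto simp: to_cube_def continuous_map_in_subtopology standard_simplex_def)
  then show ?thesis
    unfolding cube_def continuous_map_componentwise by (auto simp: to_cube_def)
qed

lemma continuous_map_from_cube:
  assumes "q < n"
  shows "continuous_map (cube n) (cyl q) (from_cube q)"
proof -
  have c: "continuous_map (cube n) euclideanreal (\<lambda>y. y i)" if "i < n" for i
    using continuous_map_product_projection [of i "{..<n}" "\<lambda>_. unit_interval"] that
    unfolding cube_def by (auto simp: continuous_map_in_subtopology)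
  define s where "s y = max 1 (\<Sum>l<q. y l)" for y :: "nat \<Rightarrow> real"
  have s1: "1 \<le> s y" and sle: "(\<Sum>l<q. y l) \<le> s y" for y by (auto simp: s_def)
  have cs: "continuous_map (cube n) euclideanreal s"
    unfolding s_def using assms by (intro continuous_intros c) auto
  have fst_eq: "fst (from_cube q y) i = (if i < q then y i / s y else if i = q then 1 - (\<Sum>l<q. y l / s y) else 0)"
    for y i by (simp add: from_cube_def s_def Let_def)
  have sn: "s y \<noteq> 0" for y using s1 [of y] by linarith
  have cq: "continuous_map (cube n) euclideanreal (\<lambda>y. y i / s y)" if "i < n" for i
    using that sn by (intro continuous_intros c cs) auto
  have in_simplex: "fst (from_cube q y) \<in> standard_simplex q" if y: "y \<in> topspace (cube n)" for y
  proof (rule standard_simplexI)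
    have y0: "0 \<le> y i" if "i < n" for i using y that by (auto simp: topspace_cube PiE_iff)
    have "(\<Sum>l<q. y l / s y) = (\<Sum>l<q. y l) / s y" by (simp add: sum_divide_distrib)
    also have "\<dots> \<le> 1" using sle [of y] s1 [of y] by simp
    finally show "0 \<le> fst (from_cube q y) i" if "i \<le> q" for i
      using y0 [of i] assms s1 [of y] by (auto simp: fst_eq)
    show "(\<Sum>i\<le>q. fst (from_cube q y) i) = 1"
      unfolding lessThan_Suc_atMost [symmetric] sum.lessThan_Suc by (simp add: fst_eq)
  qed (simp add: fst_eq)
  show ?thesis
    unfolding continuous_map_cyl_iff
  proof (intro conjI allI ballI in_simplex)
    show "continuous_map (cube n) euclideanreal (\<lambda>y. fst (from_cube q y) i)" for i
      using assms unfolding fst_eq by (cases "i < q"; cases "i = q") (auto intro!: continuous_intros cq)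
    show "continuous_map (cube n) euclideanreal (\<lambda>y. snd (from_cube q y))"
      using c [OF assms] by (simp add: from_cube_def Let_def)
    show "snd (from_cube q y) \<in> {0..1}" if "y \<in> topspace (cube n)" for y
      using that assms by (auto simp: from_cube_def Let_def topspace_cube PiE_iff)
  qed
qed

lemma from_cube_to_cube:
  assumes "q < n" "z \<in> topspace (cyl q)"
  shows "from_cube q (to_cube n q z) = z"
proof -
  obtain p t where z: "z = (p, t)" and p: "p \<in> standard_simplex q"
    using assms by (cases z) simp
  have sum: "(\<Sum>l<q. to_cube n q z l) = (\<Sum>l<q. p l)"
    using assms by (intro sum.cong) (auto simp: to_cube_def z)
  have "(\<Sum>l<q. p l) + p q = 1" "0 \<le> p q"
    using p unfolding standard_simplex_def lessThan_Suc_atMost [symmetric] sum.lessThan_Suc by simp_all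
  then have pq: "p q = 1 - (\<Sum>l<q. p l)" and s: "max 1 (\<Sum>l<q. to_cube n q z l) = 1"
    by (auto simp: sum)
  have "p i = 0" if "i > q" for i using p that by (simp add: standard_simplex_def)
  then have "(\<lambda>i. if i < q then to_cube n q z i else if i = q then 1 - (\<Sum>l<q. p l) else 0) = p"
    using pq assms by (intro ext) (simp add: to_cube_def z)
  moreover have "to_cube n q z q = t"
    using assms by (simp add: to_cube_def z)
  moreover have "from_cube q (to_cube n q z) =
      (\<lambda>i. if i < q then to_cube n q z i else if i = q then 1 - (\<Sum>l<q. p l) else 0, to_cube n q z q)"
    unfolding from_cube_def Let_def s unfolding div_by_1 sum ..
  ultimately show ?thesis unfolding z by simp
qed

text \<open>A real supremum is an upper bound only once the distances are known to be bounded;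
  compactness provides this.\<close>

lemma (in Metric_space) dist_le_mdiam:
  assumes "compactin mtopology A" "x \<in> A" "y \<in> A"
  shows "d x y \<le> mdiam d A"
proof -
  obtain B where "\<And>x y. \<lbrakk>x \<in> A; y \<in> A\<rbrakk> \<Longrightarrow> d x y \<le> B"
    using compactin_imp_mbounded [OF assms(1)] by (auto simp: mbounded_alt)
  then have "bdd_above {d x y |x y. x \<in> A \<and> y \<in> A}"
    by (auto simp: bdd_above_def)
  then show ?thesis
    unfolding mdiam_def using assms by (intro cSup_upper) auto
qed

text \<open>\<open>h\<close> is composed with the retraction of the cube onto the cylinder,
  perturbed on the cube and restricted to the embedded cylinder. The splitting property passes from
  the fibre over \<open>x\<close> in the cube to its trace on the cylinder.\<close>

lemma AP_n0_cyl:
  assumes M: "Metric_space M d" and X: "X = Metric_space.mtopology M d" and AP: "AP_n0 n X d"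
    and "q < n" and x: "x \<in> M" and h: "continuous_map (cyl q) X h" and "\<epsilon> > 0"
  shows "\<exists>G. continuous_map (prod_topology (cyl q) unit_interval) X G \<and>
            (\<forall>z \<in> topspace (cyl q). G (z, 0) = h z \<and> (\<forall>s \<in> {0..1}. d (h z) (G (z, s)) < \<epsilon>)) \<and>
            clopen_splits (cyl q) {z \<in> topspace (cyl q). G (z, 1) = x}"
proof -
  interpret Metric_space M d by (rule M)
  let ?e = "to_cube n q" and ?r = "from_cube q"
  have e: "continuous_map (cyl q) (cube n) ?e" by (rule continuous_map_to_cube)
  have r: "continuous_map (cube n) (cyl q) ?r" by (rule continuous_map_from_cube [OF \<open>q < n\<close>])
  have re: "?r (?e z) = z" if "z \<in> topspace (cyl q)" for z
    using from_cube_to_cube [OF \<open>q < n\<close> that] .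
  have eC: "?e z \<in> topspace (cube n)" if "z \<in> topspace (cyl q)" for z
    using e that by (auto simp: continuous_map_def)
  obtain g' where g': "continuous_map (cube n) X g'" "zero_dim_map (cube n) X g'"
      "eps_homotopic n X d \<epsilon> (h \<circ> ?r) g'"
    using AP [unfolded AP_n0_def, rule_format, OF \<open>\<epsilon> > 0\<close> continuous_map_compose [OF r h]] by auto
  then obtain hh where hh: "continuous_map (prod_topology (cube n) unit_interval) X hh"
      and hh01: "\<And>z. z \<in> topspace (cube n) \<Longrightarrow> hh (z, 0) = (h \<circ> ?r) z \<and> hh (z, 1) = g' z"
      and hhd: "\<And>z. z \<in> topspace (cube n) \<Longrightarrow> mdiam d ((\<lambda>t. hh (z, t)) ` {0..1}) < \<epsilon>"
    unfolding eps_homotopic_def by auto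
  define G where "G z = hh (?e (fst z), snd z)" for z
  show ?thesis
  proof (intro exI [of _ G] conjI ballI)
    have "continuous_map (prod_topology (cyl q) unit_interval) (prod_topology (cube n) unit_interval)
            (\<lambda>z. (?e (fst z), snd z))"
    proof -
      have "continuous_map (prod_topology (cyl q) unit_interval) (cube n) (\<lambda>z. ?e (fst z))"
        by (rule continuous_map_compose [OF continuous_map_fst e, unfolded o_def])
      then show ?thesis
        by (simp add: continuous_map_pairwise o_def continuous_map_snd)
    qed
    from continuous_map_compose [OF this hh]
    show "continuous_map (prod_topology (cyl q) unit_interval) X G"
      by (simp add: o_def G_def [abs_def])
    show G0: "G (z, 0) = h z" if "z \<in> topspace (cyl q)" for z
      using hh01 [OF eC [OF that]] re [OF that] by (simp add: G_def)
    show "d (h z) (G (z, s)) < \<epsilon>" if z: "z \<in> topspace (cyl q)" and s: "s \<in> {0..1}" for z s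
    proof -
      have "continuous_map unit_interval (prod_topology (cube n) unit_interval) (\<lambda>t. (?e z, t))"
        using eC [OF z] by (simp add: continuous_map_pairwise o_def)
      from continuous_map_compose [OF this hh]
      have "continuous_map unit_interval X (\<lambda>t. hh (?e z, t))" by (simp add: o_def)
      moreover have "compactin unit_interval {0..1}"
        by (simp add: compactin_subtopology)
      ultimately have "compactin X ((\<lambda>t. hh (?e z, t)) ` {0..1})"
        using image_compactin by blast
      \<comment> \<open>The track of \<open>z\<close> begins at \<open>h z\<close>, so its diameter
        bounds the displacement at every stage.\<close>
      then have "d (hh (?e z, 0)) (hh (?e z, s)) \<le> mdiam d ((\<lambda>t. hh (?e z, t)) ` {0..1})"
        unfolding X using s by (intro dist_le_mdiam) auto
      also have "\<dots> < \<epsilon>" using hhd [OF eC [OF z]] .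
      finally show ?thesis using G0 [OF z] by (simp add: G_def)
    qed
    define \<Phi> where "\<Phi> = {y \<in> topspace (cube n). g' y = x}"
    have "x \<in> topspace X" using x X by simp
    then have cov: "covdim_le_0 (subtopology (cube n) \<Phi>)"
      using g'(2) by (simp add: zero_dim_map_def \<Phi>_def)
    have "closedin X {x}"
      using x X by (metis closedin_t1_singleton Hausdorff_imp_t1_space Hausdorff_space_mtopology topspace_mtopology)
    then have "closedin (cube n) {y \<in> topspace (cube n). g' y \<in> {x}}"
      by (rule closedin_continuous_map_preimage [OF g'(1)])
    then have "closedin (cube n) \<Phi>" by (simp add: \<Phi>_def)
    then have "clopen_splits (cyl q) {z \<in> topspace (cyl q). ?e z \<in> \<Phi>}"
      by (rule covdim_le_0_imp_clopen_splits [OF cov _ e r]) (rule re)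
    moreover have "{z \<in> topspace (cyl q). ?e z \<in> \<Phi>} = {z \<in> topspace (cyl q). G (z, 1) = x}"
      using hh01 eC by (auto simp: \<Phi>_def G_def)
    ultimately show "clopen_splits (cyl q) {z \<in> topspace (cyl q). G (z, 1) = x}" by simp
  qed
qed

section \<open>Natural families of homotopies\<close>

definition drop_coord :: "nat \<Rightarrow> (nat \<Rightarrow> 'a) \<Rightarrow> nat \<Rightarrow> 'a" where
  "drop_coord k p = (\<lambda>i. if i < k then p i else p (Suc i))"

lemma simplical_face_drop_coord: "p k = 0 \<Longrightarrow> simplical_face k (drop_coord k p) = p"
  by (auto simp: simplical_face_def drop_coord_def fun_eq_iff)

lemma drop_coord_simplical_face: "drop_coord k (simplical_face k p) = p"
  by (auto simp: simplical_face_def drop_coord_def fun_eq_iff)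

text \<open>The cosimplicial identity of the coface maps, from which the simplicial identity for
  \<open>singular_face\<close> follows by precomposition.\<close>

lemma simplical_face_commute:
  "i \<le> j \<Longrightarrow> simplical_face (Suc j) (simplical_face i t) = simplical_face i (simplical_face j t)"
  by (auto simp: simplical_face_def fun_eq_iff)

lemma sum_drop_coord:
  fixes f :: "nat \<Rightarrow> real"
  shows "k \<le> Suc r \<Longrightarrow> (\<Sum>i\<le>r. drop_coord k f i) + f k = (\<Sum>i\<le>Suc r. f i)"
proof (induction r)
  case 0
  then consider "k = 0" | "k = 1" by linarith
  then show ?case by cases (auto simp: drop_coord_def)
next
  case (Suc r)
  show ?case
  proof (cases "k \<le> Suc r")
    case True
    then show ?thesis using Suc.IH by (simp add: drop_coord_def)
  next
    case False
    then have "k = Suc (Suc r)" using Suc.prems by simp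
    then show ?thesis by (simp add: drop_coord_def)
  qed
qed

lemma drop_coord_in_standard_simplex:
  assumes "p \<in> standard_simplex q" "p k = 0" "k \<le> q" "0 < q"
  shows "drop_coord k p \<in> standard_simplex (q - 1)"
proof (rule standard_simplexI)
  show "(\<Sum>i\<le>q - 1. drop_coord k p i) = 1"
    using sum_drop_coord [of k "q - 1" p] assms by (simp add: standard_simplex_def)
qed (use assms in \<open>auto simp: standard_simplex_def drop_coord_def\<close>)

lemma singular_face_singular_face:
  assumes "i \<le> j" "j \<le> Suc q"
  shows "singular_face (Suc q) i (singular_face (Suc (Suc q)) (Suc j) \<rho>) =
         singular_face (Suc q) j (singular_face (Suc (Suc q)) i \<rho>)"
proof (rule ext)
  fix t
  show "singular_face (Suc q) i (singular_face (Suc (Suc q)) (Suc j) \<rho>) t =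
         singular_face (Suc q) j (singular_face (Suc (Suc q)) i \<rho>) t"
  proof (cases "t \<in> standard_simplex q")
    case True
    then have "simplical_face i t \<in> standard_simplex (Suc q)" "simplical_face j t \<in> standard_simplex (Suc q)"
      using assms by (auto intro!: simplical_face_in_standard_simplex)
    then show ?thesis
      using True assms by (simp add: singular_face_def simplical_face_commute)
  qed (simp add: singular_face_def)
qed

section \<open>Homotopies of simplices avoiding the point at height 0\<close>

text \<open>The value is -1 up to time 1/2 and then rises linearly to 1 at time 1.\<close>

definition ramp :: "real \<Rightarrow> real" where
  "ramp t = max (-1) (4 * t - 3)"

text \<open>Prescribing the homotopy of simplices that miss \<open>x\<close> keeps chains of \<open>W - {x}\<close> inside
  \<open>(W - {x}) \<times> \<real>\<close>.\<close>
definition pushed_homotopy ::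
  "'a \<Rightarrow> 'a topology \<Rightarrow> nat \<Rightarrow> ((nat \<Rightarrow> real) \<Rightarrow> 'a) \<Rightarrow> ((nat \<Rightarrow> real) \<times> real \<Rightarrow> 'a \<times> real) \<Rightarrow> bool" where
  "pushed_homotopy x W q \<sigma> H \<longleftrightarrow>
     continuous_map (cyl q) (prod_topology W euclideanreal) H \<and>
     (\<forall>p \<in> standard_simplex q. fst (H (p, 0)) = \<sigma> p \<and> snd (H (p, 1)) = 1 \<and>
        (\<forall>t \<in> {0..1}. (t \<le> 1/2 \<longrightarrow> snd (H (p, t)) = -1) \<and> H (p, t) \<noteq> (x, 0))) \<and>
     (x \<notin> \<sigma> ` standard_simplex q \<longrightarrow>
        (\<forall>p \<in> standard_simplex q. \<forall>t \<in> {0..1}. H (p, t) = (\<sigma> p, ramp t)))"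

lemma continuous_map_cyl_fst: "continuous_map (cyl q) (simplex_space q) fst"
  and continuous_map_cyl_snd: "continuous_map (cyl q) euclideanreal snd"
  unfolding cyl_def
  by (rule continuous_map_fst, rule continuous_map_into_fulltopology [OF continuous_map_snd])

lemma pushed_homotopy_missing:
  assumes \<sigma>: "singular_simplex q W \<sigma>" and "x \<notin> \<sigma> ` standard_simplex q"
  shows "pushed_homotopy x W q \<sigma> (\<lambda>(p, t). (\<sigma> p, ramp t))"
proof -
  have "continuous_map (cyl q) W (\<lambda>z. \<sigma> (fst z))"
    using \<sigma> continuous_map_compose [OF continuous_map_cyl_fst] by (auto simp: singular_simplex_def o_def)
  moreover have "continuous_map (cyl q) euclideanreal (\<lambda>z. ramp (snd z))"
    unfolding ramp_def by (intro continuous_intros continuous_map_cyl_snd)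
  ultimately have "continuous_map (cyl q) (prod_topology W euclideanreal) (\<lambda>(p, t). (\<sigma> p, ramp t))"
    by (simp add: continuous_map_pairwise o_def case_prod_unfold)
  then show ?thesis
    using assms(2) by (auto simp: pushed_homotopy_def ramp_def image_iff)
qed

text \<open>A simplex missing \<open>x\<close> gets the prescribed homotopy; its faces miss
  \<open>x\<close> too, so the given \<open>Hf k\<close> are the prescribed ones as well. Otherwise
  the \<open>Hf k\<close> are glued over the boundary and extended over the cell by means of the
  collar.\<close>

lemma pushed_homotopy_extend:
  assumes M: "Metric_space M d" and X: "X = Metric_space.mtopology M d" and AP: "AP_n0 n X d"
    and U: "openin X U" and x: "x \<in> M" and "q < n"
    and \<sigma>: "singular_simplex q (subtopology X U) \<sigma>"
    and Hf: "\<And>k. \<lbrakk>0 < q; k \<le> q\<rbrakk> \<Longrightarrow> pushed_homotopy x (subtopology X U) (q - 1) (singular_face q k \<sigma>) (Hf k)"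
    and compat: "\<And>k k' p p' t. \<lbrakk>0 < q; k \<le> q; k' \<le> q; p \<in> standard_simplex (q - 1); p' \<in> standard_simplex (q - 1);
        t \<in> {0..1}; simplical_face k p = simplical_face k' p'\<rbrakk> \<Longrightarrow> Hf k (p, t) = Hf k' (p', t)"
  shows "\<exists>H. pushed_homotopy x (subtopology X U) q \<sigma> H \<and>
     (0 < q \<longrightarrow> (\<forall>k\<le>q. \<forall>p \<in> standard_simplex (q - 1). \<forall>t \<in> {0..1}. H (simplical_face k p, t) = Hf k (p, t)))"
proof (cases "x \<in> \<sigma> ` standard_simplex q")
  case False
  let ?H = "\<lambda>(p, t). (\<sigma> p, ramp t)"
  have "?H (simplical_face k p, t) = Hf k (p, t)"
    if "0 < q" "k \<le> q" "p \<in> standard_simplex (q - 1)" "t \<in> {0..1}" for k p t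
  proof -
    have face: "simplical_face k p' \<in> standard_simplex q" if "p' \<in> standard_simplex (q - 1)" for p'
      using simplical_face_in_standard_simplex [of q k p'] that \<open>0 < q\<close> \<open>k \<le> q\<close> by simp
    then have "x \<notin> singular_face q k \<sigma> ` standard_simplex (q - 1)"
      using False by (auto simp: singular_face_def)
    then have "Hf k (p, t) = (singular_face q k \<sigma> p, ramp t)"
      using Hf [OF that(1,2)] that(3,4) by (simp add: pushed_homotopy_def)
    then show ?thesis using that(3) by (simp add: singular_face_def)
  qed
  then show ?thesis using pushed_homotopy_missing [OF \<sigma> False] by blast
next
  case True
  let ?W = "subtopology X U"
  let ?B = "simplex_boundary q"
  \<comment> \<open>A vanishing coordinate of a boundary point selects a face containing it; by
    \<open>compat\<close> the choice does not matter.\<close>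
  define zero_ix where "zero_ix p = (SOME k. k \<le> q \<and> p k = 0)" for p :: "nat \<Rightarrow> real"
  define Hb where "Hb z = Hf (zero_ix (fst z)) (drop_coord (zero_ix (fst z)) (fst z), snd z)" for z
  have zero_ix: "zero_ix p \<le> q" "p (zero_ix p) = 0" if "p \<in> ?B" for p
    using someI_ex [of "\<lambda>k. k \<le> q \<and> p k = 0"] that by (auto simp: simplex_boundary_def zero_ix_def)
  have B: "p \<in> standard_simplex q" if "p \<in> ?B" for p
    using that by (simp add: simplex_boundary_def)
  \<comment> \<open>The 0-simplex has empty boundary, its only coordinate being 1.\<close>
  have q0: "0 < q" if "p \<in> ?B" for p
    using that by (auto simp: simplex_boundary_def standard_simplex_def intro!: gr0I)
  have Hb_eq: "Hb (p, t) = Hf k (drop_coord k p, t)" if "p \<in> ?B" "k \<le> q" "p k = 0" "t \<in> {0..1}" for p k t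
    unfolding Hb_def fst_conv snd_conv
    using that zero_ix [OF that(1)] B [OF that(1)] q0 [OF that(1)]
    by (intro compat) (auto simp: simplical_face_drop_coord intro!: drop_coord_in_standard_simplex [simplified])
  have drop_in: "drop_coord (zero_ix p) p \<in> standard_simplex (q - 1)" if "p \<in> ?B" for p
    using drop_coord_in_standard_simplex [OF B [OF that] zero_ix(2,1) [OF that] q0 [OF that]] .
  note good = Hf [unfolded pushed_homotopy_def]
  let ?Y = "subtopology (cyl q) (?B \<times> {0..1})"
  have topY: "topspace ?Y = ?B \<times> {0..1}" using B by auto
  have "continuous_map ?Y (cyl q) (\<lambda>z. z)"
    by (simp add: continuous_map_from_subtopology)
  then have cYi: "continuous_map ?Y euclideanreal (\<lambda>z. fst z i)"
    and cYs: "continuous_map ?Y euclideanreal snd" for i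
    by (simp_all add: continuous_map_cyl_iff)
  have cHb: "continuous_map ?Y (prod_topology ?W euclideanreal) Hb"
  \<comment> \<open>Each face is the closed set where its coordinate vanishes; these finitely many
    sets cover the side.\<close>
  proof (rule pasting_lemma_closed [where I = "{k. 0 < q \<and> k \<le> q}"
        and T = "\<lambda>k. {z \<in> topspace ?Y. fst z k \<in> {0}}"
        and f = "\<lambda>k z. Hf k (drop_coord k (fst z), snd z)"])
    fix k assume "k \<in> {k. 0 < q \<and> k \<le> q}"
    then have k: "0 < q" "k \<le> q" by auto
    let ?Z = "subtopology ?Y {z \<in> topspace ?Y. fst z k \<in> {0}}"
    show "closedin ?Y {z \<in> topspace ?Y. fst z k \<in> {0}}"
      by (rule closedin_continuous_map_preimage [OF cYi]) simp
    have "continuous_map ?Z (cyl (q - 1)) (\<lambda>z. (drop_coord k (fst z), snd z))"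
      unfolding continuous_map_cyl_iff fst_conv snd_conv
    proof (intro conjI allI ballI)
      show "continuous_map ?Z euclideanreal (\<lambda>z. drop_coord k (fst z) i)" for i
        unfolding drop_coord_def by (cases "i < k") (simp_all add: continuous_map_from_subtopology cYi)
      show "continuous_map ?Z euclideanreal snd"
        by (rule continuous_map_from_subtopology [OF cYs])
      fix z assume "z \<in> topspace ?Z"
      then have "fst z \<in> ?B" "snd z \<in> {0..1}" "fst z k = 0" by auto
      then show "snd z \<in> {0..1}" "drop_coord k (fst z) \<in> standard_simplex (q - 1)"
        using drop_coord_in_standard_simplex [OF B] k by auto
    qed
    from continuous_map_compose [OF this conjunct1 [OF good [OF k]]]
    show "continuous_map ?Z (prod_topology ?W euclideanreal) (\<lambda>z. Hf k (drop_coord k (fst z), snd z))"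
      by (simp add: o_def)
  next
    fix i j z
    assume "i \<in> {k. 0 < q \<and> k \<le> q}" "j \<in> {k. 0 < q \<and> k \<le> q}"
      and z: "z \<in> topspace ?Y \<inter> {z \<in> topspace ?Y. fst z i \<in> {0}} \<inter> {z \<in> topspace ?Y. fst z j \<in> {0}}"
    then have ij: "i \<le> q" "j \<le> q" by auto
    obtain p t where pt: "z = (p, t)" by (cases z)
    have "p \<in> ?B" "t \<in> {0..1}" "p i = 0" "p j = 0"
      using z unfolding topY pt by auto
    then show "Hf i (drop_coord i (fst z), snd z) = Hf j (drop_coord j (fst z), snd z)"
      using Hb_eq [of p i t] Hb_eq [of p j t] ij by (simp add: pt)
  next
    fix z assume z: "z \<in> topspace ?Y"
    then have "fst z \<in> ?B" unfolding topY by auto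
    then show "\<exists>j. j \<in> {k. 0 < q \<and> k \<le> q} \<and> z \<in> {z \<in> topspace ?Y. fst z j \<in> {0}} \<and>
        Hb z = Hf j (drop_coord j (fst z), snd z)"
      using zero_ix q0 z by (intro exI [of _ "zero_ix (fst z)"]) (auto simp: Hb_def)
  qed simp
  have ex: "\<exists>k y. 0 < q \<and> k \<le> q \<and> y \<in> standard_simplex (q - 1) \<and> p = simplical_face k y \<and>
      (\<forall>t \<in> {0..1}. Hb (p, t) = Hf k (y, t))" if "p \<in> ?B" for p
    using zero_ix [OF that] drop_in [OF that] q0 [OF that]
    by (intro exI [of _ "zero_ix p"] exI [of _ "drop_coord (zero_ix p) p"])
       (simp add: simplical_face_drop_coord Hb_def)
  have cont\<sigma>: "continuous_map (simplex_space q) ?W \<sigma>"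
    using \<sigma> by (simp add: singular_simplex_def)
  obtain H where H: "continuous_map (cyl q) (prod_topology ?W euclideanreal) H"
    "\<And>p. p \<in> topspace (simplex_space q) \<Longrightarrow> fst (H (p, 0)) = \<sigma> p"
    "\<And>p t. \<lbrakk>p \<in> topspace (simplex_space q); 0 \<le> t; t \<le> 1/2\<rbrakk> \<Longrightarrow> snd (H (p, t)) = -1"
    "\<And>p. p \<in> topspace (simplex_space q) \<Longrightarrow> snd (H (p, 1)) = 1"
    "\<And>p t. \<lbrakk>p \<in> topspace (simplex_space q); t \<in> {0..1}\<rbrakk> \<Longrightarrow> H (p, t) \<noteq> (x, 0)"
    "\<And>p t. \<lbrakk>p \<in> ?B; t \<in> {0..1}\<rbrakk> \<Longrightarrow> H (p, t) = Hb (p, t)"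
  proof (rule extend_over_collared_cell [OF M X U x _ _ collar_standard_simplex [of q] _ cont\<sigma>, folded cyl_def, of Hb])
    show "compact_space (simplex_space q)"
      by (rule compact_space_subtopology [OF compactin_standard_simplex])
    show "Hausdorff_space (simplex_space q)"
      by (intro Hausdorff_space_subtopology) (simp add: Hausdorff_space_product_topology)
    fix h \<epsilon> assume "continuous_map (cyl q) X h" "(0::real) < \<epsilon>"
    then show "\<exists>G. continuous_map (prod_topology (cyl q) unit_interval) X G \<and>
            (\<forall>z \<in> topspace (cyl q). G (z, 0) = h z \<and> (\<forall>s \<in> {0..1}. d (h z) (G (z, s)) < \<epsilon>)) \<and>
            clopen_splits (cyl q) {z \<in> topspace (cyl q). G (z, 1) = x}"
      by (rule AP_n0_cyl [OF M X AP \<open>q < n\<close> x])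
  next
    fix p assume p: "p \<in> ?B"
    obtain k y where ky: "0 < q" "k \<le> q" "y \<in> standard_simplex (q - 1)" "p = simplical_face k y"
      and Hbk: "\<And>t. t \<in> {0..1} \<Longrightarrow> Hb (p, t) = Hf k (y, t)"
      using ex [OF p] by blast
    note gk = good [OF ky(1,2)]
    show "fst (Hb (p, 0)) = \<sigma> p"
      using gk ky(3) by (simp add: Hbk singular_face_def flip: ky(4))
    show "snd (Hb (p, 1)) = 1"
      using gk ky(3) by (simp add: Hbk)
    show "snd (Hb (p, t)) = -1" if "0 \<le> t" "t \<le> 1/2" for t
      using gk ky(3) that by (simp add: Hbk)
    show "Hb (p, t) \<noteq> (x, 0)" if "t \<in> {0..1}" for t
      using gk ky(3) that by (simp add: Hbk)
  qed (rule cHb, rule that)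
  \<comment> \<open>The clause on simplices missing \<open>x\<close> is vacuous here.\<close>
  have "pushed_homotopy x ?W q \<sigma> H"
    using H(1-5) True by (simp add: pushed_homotopy_def)
  moreover have "H (simplical_face k p, t) = Hf k (p, t)"
    if "0 < q" "k \<le> q" "p \<in> standard_simplex (q - 1)" "t \<in> {0..1}" for k p t
  proof -
    have "simplical_face k p \<in> ?B"
      using simplical_face_in_standard_simplex [of q k p] that
      by (auto simp: simplex_boundary_def simplical_face_def)
    then show ?thesis
      using H(6) Hb_eq [of "simplical_face k p" k t] that
      by (simp add: drop_coord_simplical_face) (simp add: simplical_face_def)
  qed
  ultimately show ?thesis by blast
qed

text \<open>Recursion on the dimension. To extend over a simplex, the homotopies of its faces must
  agree where faces meet; by the simplicial identity both restrict there to the homotopy of a common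
  face of codimension 2.\<close>

lemma natural_pushed_homotopies:
  assumes M: "Metric_space M d" and X: "X = Metric_space.mtopology M d" and AP: "AP_n0 n X d"
    and U: "openin X U" and x: "x \<in> M"
  obtains H where
    "\<And>q \<sigma>. \<lbrakk>q < n; singular_simplex q (subtopology X U) \<sigma>\<rbrakk> \<Longrightarrow> pushed_homotopy x (subtopology X U) q \<sigma> (H q \<sigma>)"
    "\<And>q \<sigma> k p t. \<lbrakk>Suc q < n; singular_simplex (Suc q) (subtopology X U) \<sigma>; k \<le> Suc q;
        p \<in> standard_simplex q; t \<in> {0..1}\<rbrakk> \<Longrightarrow>
      H (Suc q) \<sigma> (simplical_face k p, t) = H q (singular_face (Suc q) k \<sigma>) (p, t)"
proof -
  let ?W = "subtopology X U"
  \<comment> \<open>Besides the homotopies themselves, \<open>?P\<close> records their agreement on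
    common points of two faces of a simplex one dimension higher, ready for the next
    extension.\<close>
  let ?P = "\<lambda>q \<Phi>. (\<forall>\<sigma>. q < n \<and> singular_simplex q ?W \<sigma> \<longrightarrow> pushed_homotopy x ?W q \<sigma> (\<Phi> \<sigma>)) \<and>
     (\<forall>\<rho> k k' p p' t. q < n \<and> singular_simplex (Suc q) ?W \<rho> \<and> k \<le> Suc q \<and> k' \<le> Suc q \<and>
        p \<in> standard_simplex q \<and> p' \<in> standard_simplex q \<and> t \<in> {0..1} \<and>
        simplical_face k p = simplical_face k' p' \<longrightarrow>
        \<Phi> (singular_face (Suc q) k \<rho>) (p, t) = \<Phi> (singular_face (Suc q) k' \<rho>) (p', t))"
  let ?Q = "\<lambda>q \<Phi> \<Psi>. \<forall>\<sigma> k p t. Suc q < n \<and> singular_simplex (Suc q) ?W \<sigma> \<and> k \<le> Suc q \<and>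
        p \<in> standard_simplex q \<and> t \<in> {0..1} \<longrightarrow>
        \<Psi> \<sigma> (simplical_face k p, t) = \<Phi> (singular_face (Suc q) k \<sigma>) (p, t)"
  have "\<exists>H. \<forall>q. ?P q (H q) \<and> ?Q q (H q) (H (Suc q))"
  proof (rule dependent_nat_choice)
    have "\<forall>\<sigma>. \<exists>H. 0 < n \<and> singular_simplex 0 ?W \<sigma> \<longrightarrow> pushed_homotopy x ?W 0 \<sigma> H"
      using pushed_homotopy_extend [OF M X AP U x, of 0] by blast
    then obtain \<Phi> where \<Phi>: "\<And>\<sigma>. 0 < n \<and> singular_simplex 0 ?W \<sigma> \<longrightarrow> pushed_homotopy x ?W 0 \<sigma> (\<Phi> \<sigma>)"
      by metis
    \<comment> \<open>The two faces of an edge are its distinct ends, so agreement is automatic in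
      dimension 0.\<close>
    have same: "k = k' \<and> p = p'" if "k \<le> Suc 0" "k' \<le> Suc 0" "p \<in> standard_simplex 0" "p' \<in> standard_simplex 0"
        "simplical_face k p = simplical_face k' p'" for k k' and p p' :: "nat \<Rightarrow> real"
    proof -
      have pp: "p = p'" "p 0 = 1" using that by (auto simp: standard_simplex_0)
      then show ?thesis
        using fun_cong [OF that(5), of 0] that(1,2) by (auto simp: simplical_face_def le_Suc_eq split: if_splits)
    qed
    show "\<exists>\<Phi>. ?P 0 \<Phi>"
    proof (intro exI [of _ \<Phi>] conjI allI impI)
      fix \<sigma> assume "0 < n \<and> singular_simplex 0 ?W \<sigma>"
      then show "pushed_homotopy x ?W 0 \<sigma> (\<Phi> \<sigma>)" by (rule \<Phi> [rule_format])
    next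
      fix \<rho> k k' p p' t
      assume A: "0 < n \<and> singular_simplex (Suc 0) ?W \<rho> \<and> k \<le> Suc 0 \<and> k' \<le> Suc 0 \<and>
        p \<in> standard_simplex 0 \<and> p' \<in> standard_simplex 0 \<and> t \<in> {0..1::real} \<and>
        simplical_face k p = simplical_face k' p'"
      then have "k = k'" "p = p'" using same [of k k' p p'] by simp_all
      then show "\<Phi> (singular_face (Suc 0) k \<rho>) (p, t) = \<Phi> (singular_face (Suc 0) k' \<rho>) (p', t)"
        by simp
    qed
  next
    fix \<Phi> q assume P: "?P q \<Phi>"
    have step: "\<exists>H. Suc q < n \<and> singular_simplex (Suc q) ?W \<sigma> \<longrightarrow> pushed_homotopy x ?W (Suc q) \<sigma> H \<and>
        (\<forall>k \<le> Suc q. \<forall>p \<in> standard_simplex q. \<forall>t \<in> {0..1}.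
           H (simplical_face k p, t) = \<Phi> (singular_face (Suc q) k \<sigma>) (p, t))" for \<sigma>
    proof (cases "Suc q < n \<and> singular_simplex (Suc q) ?W \<sigma>")
      case True
      then have n: "Suc q < n" "q < n" and \<sigma>: "singular_simplex (Suc q) ?W \<sigma>" by auto
      have faces: "pushed_homotopy x ?W (Suc q - 1) (singular_face (Suc q) k \<sigma>) (\<Phi> (singular_face (Suc q) k \<sigma>))"
        if "k \<le> Suc q" for k
        using P n(2) singular_simplex_singular_face [OF \<sigma> _ that] by simp
      have compat: "\<Phi> (singular_face (Suc q) k \<sigma>) (p, t) = \<Phi> (singular_face (Suc q) k' \<sigma>) (p', t)"
        if "k \<le> Suc q" "k' \<le> Suc q" "p \<in> standard_simplex (Suc q - 1)" "p' \<in> standard_simplex (Suc q - 1)"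
          "t \<in> {0..1}" "simplical_face k p = simplical_face k' p'" for k k' p p' t
        by (rule conjunct2 [OF P, rule_format]) (use that n(2) \<sigma> in simp)
      have "\<exists>H. pushed_homotopy x ?W (Suc q) \<sigma> H \<and>
         (0 < Suc q \<longrightarrow> (\<forall>k\<le>Suc q. \<forall>p \<in> standard_simplex (Suc q - 1). \<forall>t \<in> {0..1}.
            H (simplical_face k p, t) = \<Phi> (singular_face (Suc q) k \<sigma>) (p, t)))"
        by (rule pushed_homotopy_extend [OF M X AP U x n(1) \<sigma> faces compat])
      then show ?thesis by simp
    qed blast
    let ?R = "\<lambda>\<sigma> H. Suc q < n \<and> singular_simplex (Suc q) ?W \<sigma> \<longrightarrow> pushed_homotopy x ?W (Suc q) \<sigma> H \<and>
        (\<forall>k \<le> Suc q. \<forall>p \<in> standard_simplex q. \<forall>t \<in> {0..1}.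
           H (simplical_face k p, t) = \<Phi> (singular_face (Suc q) k \<sigma>) (p, t))"
    have "\<forall>\<sigma>. \<exists>H. ?R \<sigma> H"
      by (rule allI) (rule step)
    from choice [OF this] obtain \<Psi> where \<Psi>0: "\<forall>\<sigma>. ?R \<sigma> (\<Psi> \<sigma>)" by (rule exE)
    note \<Psi> = spec [OF \<Psi>0]
    have less: "\<Psi> (singular_face (Suc (Suc q)) k \<rho>) (p, t) = \<Psi> (singular_face (Suc (Suc q)) k' \<rho>) (p', t)"
      if "k < k'" and n: "Suc q < n" and \<rho>: "singular_simplex (Suc (Suc q)) ?W \<rho>" and k': "k' \<le> Suc (Suc q)"
        and p: "p \<in> standard_simplex (Suc q)" and p': "p' \<in> standard_simplex (Suc q)" and t: "t \<in> {0..1}"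
        and eq: "simplical_face k p = simplical_face k' p'" for \<rho> k k' p p' t
    proof -
      \<comment> \<open>As \<open>k < k'\<close>, slot \<open>k'\<close> of the common point is slot
        \<open>j = k' - 1\<close> of \<open>p\<close>. It is 0, so \<open>p\<close> and
        \<open>p'\<close> both come from one point \<open>z\<close> of a simplex of dimension one
        less.\<close>
      obtain j where j: "k' = Suc j" "k \<le> j" "j \<le> Suc q" using \<open>k < k'\<close> k' by (cases k') auto
      have "p j = simplical_face k p k'" using j by (simp add: simplical_face_def)
      then have "p j = 0" by (simp add: eq) (simp add: simplical_face_def)
      define z where "z = drop_coord j p"
      have z: "z \<in> standard_simplex q"
        using drop_coord_in_standard_simplex [OF p \<open>p j = 0\<close> j(3)] by (simp add: z_def)
      have pz: "p = simplical_face j z"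
        using \<open>p j = 0\<close> by (simp add: z_def simplical_face_drop_coord)
      have "simplical_face k' (simplical_face k z) = simplical_face k (simplical_face j z)"
        unfolding j(1) by (rule simplical_face_commute [OF j(2)])
      also have "\<dots> = simplical_face k' p'"
        by (simp only: pz [symmetric] eq)
      finally have "drop_coord k' (simplical_face k' (simplical_face k z)) = drop_coord k' (simplical_face k' p')"
        by simp
      then have p'z: "p' = simplical_face k z"
        by (simp only: drop_coord_simplical_face)
      have sing: "singular_simplex (Suc q) ?W (singular_face (Suc (Suc q)) i \<rho>)" if "i \<le> Suc (Suc q)" for i
        using singular_simplex_singular_face [OF \<rho> _ that] by simp
      have "\<Psi> (singular_face (Suc (Suc q)) k \<rho>) (p, t)
          = \<Phi> (singular_face (Suc q) j (singular_face (Suc (Suc q)) k \<rho>)) (z, t)"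
        using \<Psi> [of "singular_face (Suc (Suc q)) k \<rho>"] n sing [of k] j z t by (simp add: pz)
      also have "\<dots> = \<Phi> (singular_face (Suc q) k (singular_face (Suc (Suc q)) k' \<rho>)) (z, t)"
        using j by (simp add: singular_face_singular_face)
      also have "\<dots> = \<Psi> (singular_face (Suc (Suc q)) k' \<rho>) (p', t)"
        using \<Psi> [of "singular_face (Suc (Suc q)) k' \<rho>"] n sing [OF k'] j z t by (simp add: p'z)
      finally show ?thesis .
    qed
    have coh: "\<Psi> (singular_face (Suc (Suc q)) k \<rho>) (p, t) = \<Psi> (singular_face (Suc (Suc q)) k' \<rho>) (p', t)"
      if "Suc q < n" "singular_simplex (Suc (Suc q)) ?W \<rho>" "k \<le> Suc (Suc q)" "k' \<le> Suc (Suc q)"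
        "p \<in> standard_simplex (Suc q)" "p' \<in> standard_simplex (Suc q)" "t \<in> {0..1}"
        "simplical_face k p = simplical_face k' p'" for \<rho> k k' p p' t
    proof (cases k k' rule: linorder_cases)
      case equal
      \<comment> \<open>\<open>simplical_face k\<close> is injective, having a left inverse.\<close>
      then show ?thesis using that(8) by (metis drop_coord_simplical_face)
    next
      case greater
      then show ?thesis using less [of k' k] that by simp
    qed (use less that in blast)
    show "\<exists>\<Psi>. ?P (Suc q) \<Psi> \<and> ?Q q \<Phi> \<Psi>"
    proof (intro exI [of _ \<Psi>] conjI allI impI; elim conjE)
      fix \<sigma> assume "Suc q < n" "singular_simplex (Suc q) ?W \<sigma>"
      then show "pushed_homotopy x ?W (Suc q) \<sigma> (\<Psi> \<sigma>)" using \<Psi> [of \<sigma>] by blast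
    next
      fix \<sigma> k p and t :: real
      assume "Suc q < n" "singular_simplex (Suc q) ?W \<sigma>" "k \<le> Suc q" "p \<in> standard_simplex q" "t \<in> {0..1}"
      then show "\<Psi> \<sigma> (simplical_face k p, t) = \<Phi> (singular_face (Suc q) k \<sigma>) (p, t)"
        using \<Psi> [of \<sigma>] by blast
    qed (rule coh)
  qed
  then obtain H where H: "\<forall>q. ?P q (H q) \<and> ?Q q (H q) (H (Suc q))" by (rule exE)
  show thesis
  proof (rule that [of H])
    show "pushed_homotopy x ?W q \<sigma> (H q \<sigma>)" if "q < n" "singular_simplex q ?W \<sigma>" for q \<sigma>
      using conjunct1 [OF conjunct1 [OF spec [OF H, of q]]] that by blast
    show "H (Suc q) \<sigma> (simplical_face k p, t) = H q (singular_face (Suc q) k \<sigma>) (p, t)"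
      if "Suc q < n" "singular_simplex (Suc q) ?W \<sigma>" "k \<le> Suc q" "p \<in> standard_simplex q" "t \<in> {0..1}"
      for q \<sigma> k p t
      using conjunct2 [OF spec [OF H, of q]] that by blast
  qed
qed

section \<open>Vanishing of the local homology groups below degree \<open>n\<close>\<close>

theorem theorem6p6:
  fixes X :: "'a topology" and M :: "'a set" and d :: "'a \<Rightarrow> 'a \<Rightarrow> real" and n :: nat
  assumes "Metric_space M d"
    and "X = Metric_space.mtopology M d"
    and "locally_path_connected_space X"
    and "AP_n0 n X d"
  shows "\<forall>x \<in> topspace X. \<forall>U k. openin X U \<and> k < int n \<longrightarrow>
           trivial_group (relative_homology_group k (subtopology X U) (U - {x}))"
proof (intro ballI allI impI, elim conjE)
  fix x U and k :: int
  assume xX: "x \<in> topspace X" and U: "openin X U" and kn: "k < int n"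
  interpret Metric_space M d by (rule assms(1))
  let ?W = "subtopology X U"
  have x: "x \<in> M" using xX assms(2) by simp
  have topW: "topspace ?W = U" using openin_subset [OF U] by auto
  show "trivial_group (relative_homology_group k ?W (U - {x}))"
  proof (cases "k < 0 \<or> x \<notin> U")
    \<comment> \<open>In negative degrees the group is trivial by definition; if \<open>x\<close> is
      not in \<open>U\<close>, the pair is \<open>(U, U)\<close>.\<close>
    case True
    then show ?thesis
      using trivial_relative_homology_group_topspace [of k ?W] topW by (auto simp del: topspace_subtopology)
  next
    case False
    then obtain q where q: "k = int q" "q < n" and xU: "x \<in> U"
      using kn by (metis int_nat_eq not_less of_nat_less_iff)
    have "closedin X {x}"
      using xX assms(2) closedin_t1_singleton [OF Hausdorff_imp_t1_space [OF Hausdorff_space_mtopology]] by simp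
    then have clo: "closedin ?W {x}"
      using xU by (intro closedin_subset_topspace) auto
    obtain H where H: "\<And>q \<sigma>. \<lbrakk>q < n; singular_simplex q ?W \<sigma>\<rbrakk> \<Longrightarrow> pushed_homotopy x ?W q \<sigma> (H q \<sigma>)"
      and nat: "\<And>q \<sigma> k p t. \<lbrakk>Suc q < n; singular_simplex (Suc q) ?W \<sigma>; k \<le> Suc q;
        p \<in> standard_simplex q; t \<in> {0..1}\<rbrakk> \<Longrightarrow>
        H (Suc q) \<sigma> (simplical_face k p, t) = H q (singular_face (Suc q) k \<sigma>) (p, t)"
      using natural_pushed_homotopies [OF assms(1,2,4) U x] by blast
    have "trivial_group (relative_homology_group (int q) ?W (topspace ?W - {x}))"
    proof (rule trivial_relative_homology_by_natural_homotopy [OF clo, where H = H])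
      fix r \<sigma> assume r: "r \<le> q" and \<sigma>: "singular_simplex r ?W \<sigma>"
      then have Hr: "pushed_homotopy x ?W r \<sigma> (H r \<sigma>)" using H q by simp
      then show "continuous_map (cyl r) (subtopology (prod_topology ?W euclideanreal) (- {(x, 0)})) (H r \<sigma>)"
        by (auto simp: pushed_homotopy_def continuous_map_in_subtopology)
      show "fst (H r \<sigma> z) \<noteq> x" if "x \<notin> \<sigma> ` standard_simplex r" "z \<in> topspace (cyl r)" for z
        using Hr that by (auto simp: pushed_homotopy_def image_iff)
    next
      fix \<sigma> p assume \<sigma>: "singular_simplex q ?W \<sigma>" and p: "p \<in> standard_simplex q"
      have Hq: "pushed_homotopy x ?W q \<sigma> (H q \<sigma>)" using H [OF q(2) \<sigma>] .
      show "H q \<sigma> (p, 0) = (\<sigma> p, -1)"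
        using Hq p by (auto simp: pushed_homotopy_def prod_eq_iff)
      show "snd (H q \<sigma> (p, 1)) > 0"
        using Hq p by (auto simp: pushed_homotopy_def)
    next
      fix \<sigma> k p t
      assume "0 < q" "singular_simplex q ?W \<sigma>" "k \<le> q" "p \<in> standard_simplex (q - 1)" "t \<in> {0..1::real}"
      then show "H (q - 1) (singular_face q k \<sigma>) (p, t) = H q \<sigma> (simplical_face k p, t)"
        using nat [of "q - 1" \<sigma> k p t] q(2) by simp
    qed
    then show ?thesis using q(1) topW by simp
  qed
qed

end
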